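(* Let $p$ be a prime, $n\ge 1$, and let $G=\operatorname{AGL}(1,p^n)\cong \mathbb{F}_{p^n}\rtimes\mathbb{F}_{p^n}^\times$ be the group of affine maps $x\mapsto \lambda x+\mu$ ($\lambda\in\mathbb{F}_{p^n}^\times$, $\mu\in\mathbb{F}_{p^n}$), where $\mathbb{F}_{p^n}^\times$ acts on the additive group $\mathbb{F}_{p^n}$ by multiplication. Then \[ w(G)=\Omega(p^n-1)+\tau(n), \] where $\Omega(m)$ is the number of prime factors of $m$ counted with multiplicity and $\tau(m)$ is the number of positive divisors of $m$.
   Context: For a finite group $G$, a $G$-transfer system is a partial order $\to$ on the set $\operatorname{Sub}(G)$ of subgroups of $G$ such that: (i) $K\to H$ implies $K\le H$; (ii) $H\to H$ for all $H$; (iii) $L\to K$ and $K\to H$ imply $L\to H$; (iv) $K\to H$ and $L\le H$ imply $K\cap L\to H\cap L$; (v) $K\to H$ implies $gKg^{-1}\to gHg^{-1}$ for all $g\in G$. A set $S$ of pairs $(K,H)$ with $K\le H$ generates the smallest transfer system containing $S$. The complete $G$-transfer system is the one with $K\to H$ for all $K\le H$. The width $w(G)$ is the minimal cardinality of a set generating the complete $G$-transfer system. *)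

theory Defs
  imports
    "HOL-Algebra.Bij"
    "HOL-Algebra.Coset"
    "HOL-Algebra.Ring"
    "HOL-Computational_Algebra.Primes"
begin

definition inclusions :: "('a, 'b) monoid_scheme \<Rightarrow> ('a set \<times> 'a set) set" where
  "inclusions G = {(K, H). subgroup K G \<and> subgroup H G \<and> K \<subseteq> H}"

(* The pair (K, H) stands for K \<rightarrow> H; reflexivity and transitivity are part of
   partial_order_on. *)
definition transfer_system ::
    "('a, 'b) monoid_scheme \<Rightarrow> ('a set \<times> 'a set) set \<Rightarrow> bool" where
  "transfer_system G T \<longleftrightarrow>
     partial_order_on {H. subgroup H G} T \<and>
     (\<forall>K H. (K, H) \<in> T \<longrightarrow> K \<subseteq> H) \<and>
     (\<forall>K H L. (K, H) \<in> T \<longrightarrow> subgroup L G \<longrightarrow> L \<subseteq> H \<longrightarrow> (K \<inter> L, H \<inter> L) \<in> T) \<and>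
     (\<forall>K H. \<forall>g\<in>carrier G. (K, H) \<in> T \<longrightarrow>
        (g <#\<^bsub>G\<^esub> K #>\<^bsub>G\<^esub> inv\<^bsub>G\<^esub> g, g <#\<^bsub>G\<^esub> H #>\<^bsub>G\<^esub> inv\<^bsub>G\<^esub> g) \<in> T)"

definition generated_transfer_system ::
    "('a, 'b) monoid_scheme \<Rightarrow> ('a set \<times> 'a set) set \<Rightarrow> ('a set \<times> 'a set) set" where
  "generated_transfer_system G S = \<Inter>{T. transfer_system G T \<and> S \<subseteq> T}"

(* The complete transfer system is the set of all inclusions of subgroups. *)
definition width :: "('a, 'b) monoid_scheme \<Rightarrow> nat" where
  "width G = (LEAST k. \<exists>S. S \<subseteq> inclusions G \<and> finite S \<and> card S = k \<and>
                generated_transfer_system G S = inclusions G)"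

definition AGL1 :: "('a, 'b) ring_scheme \<Rightarrow> ('a \<Rightarrow> 'a) monoid" where
  "AGL1 R = BijGroup (carrier R)
     \<lparr>carrier := {\<lambda>x\<in>carrier R. l \<otimes>\<^bsub>R\<^esub> x \<oplus>\<^bsub>R\<^esub> m | l m. l \<in> Units R \<and> m \<in> carrier R}\<rparr>"

lemma (in group) subgroup_conjugate:
  assumes "subgroup H G" "g \<in> carrier G"
  shows "subgroup (g <#\<^bsub>G\<^esub> H #>\<^bsub>G\<^esub> inv g) G"
proof -
  interpret H: subgroup H G by fact
  have eq: "g <#\<^bsub>G\<^esub> H #>\<^bsub>G\<^esub> inv g = (\<lambda>h. g \<otimes> h \<otimes> inv g) ` H"
    by (auto simp: l_coset_def r_coset_def)
  have hom: "(\<lambda>h. g \<otimes> h \<otimes> inv g) \<in> hom G G"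
  proof (rule homI)
    fix x y assume xy: "x \<in> carrier G" "y \<in> carrier G"
    have "(g \<otimes> x \<otimes> inv g) \<otimes> (g \<otimes> y \<otimes> inv g) = g \<otimes> x \<otimes> (inv g \<otimes> g) \<otimes> y \<otimes> inv g"
      using assms(2) xy by (simp only: m_assoc m_closed inv_closed)
    then show "g \<otimes> (x \<otimes> y) \<otimes> inv g = (g \<otimes> x \<otimes> inv g) \<otimes> (g \<otimes> y \<otimes> inv g)"
      using assms(2) xy by (simp add: l_inv m_assoc)
  qed (use assms(2) in simp)
  then interpret group_hom G G "\<lambda>h. g \<otimes> h \<otimes> inv g"
    by (simp add: group_hom_def group_hom_axioms_def is_group)
  show ?thesis
    unfolding eq by (rule subgroup_img_is_subgroup) fact
qed

lemma (in group) transfer_system_inclusions: "transfer_system G (inclusions G)"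
  unfolding transfer_system_def
proof (intro conjI allI ballI impI)
  show "partial_order_on {H. subgroup H G} (inclusions G)"
    unfolding partial_order_on_def preorder_on_def
    by (auto simp: inclusions_def refl_on_def trans_def antisym_def)
next
  fix K H g assume "g \<in> carrier G" "(K, H) \<in> inclusions G"
  moreover from this have "g <#\<^bsub>G\<^esub> K #>\<^bsub>G\<^esub> inv g \<subseteq> g <#\<^bsub>G\<^esub> H #>\<^bsub>G\<^esub> inv g"
    by (auto simp: inclusions_def l_coset_def r_coset_def)
  ultimately show "(g <#\<^bsub>G\<^esub> K #>\<^bsub>G\<^esub> inv g, g <#\<^bsub>G\<^esub> H #>\<^bsub>G\<^esub> inv g) \<in> inclusions G"
    by (simp add: inclusions_def subgroup_conjugate)
qed (auto simp: inclusions_def subgroups_Inter_pair)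

lemma (in group) transfer_system_generated:
  assumes "S \<subseteq> inclusions G"
  shows "transfer_system G (generated_transfer_system G S)"
proof -
  let ?A = "{T. transfer_system G T \<and> S \<subseteq> T}"
  have gen: "generated_transfer_system G S = \<Inter>?A"
    by (rule generated_transfer_system_def)
  have sub: "\<Inter>?A \<subseteq> inclusions G"
    using assms transfer_system_inclusions by blast
  have ts: "transfer_system G T" if "T \<in> ?A" for T
    using that by simp
  have po: "refl_on {H. subgroup H G} T" "trans T" if "T \<in> ?A" for T
    using ts[OF that] by (simp_all add: transfer_system_def partial_order_on_def preorder_on_def)
  have "refl_on {H. subgroup H G} (\<Inter>?A)"
    using po(1) by (simp add: refl_on_def)
  moreover have "trans (\<Inter>?A)"
  proof (rule transI, rule InterI)
    fix L K H T assume LK: "(L, K) \<in> \<Inter>?A" and KH: "(K, H) \<in> \<Inter>?A" and T: "T \<in> ?A"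
    show "(L, H) \<in> T"
      by (rule transD[OF po(2)[OF T] InterD[OF LK T] InterD[OF KH T]])
  qed
  moreover have "inclusions G \<subseteq> {H. subgroup H G} \<times> {H. subgroup H G}" "antisym (inclusions G)"
    by (auto simp: inclusions_def antisym_def)
  moreover from this have "\<Inter>?A \<subseteq> {H. subgroup H G} \<times> {H. subgroup H G}" "antisym (\<Inter>?A)"
    using sub order_trans[OF sub] antisym_subset[OF sub] by fast+
  ultimately have 1: "partial_order_on {H. subgroup H G} (\<Inter>?A)"
    unfolding partial_order_on_def preorder_on_def by (intro conjI)
  have 2: "K \<subseteq> H" if "(K, H) \<in> \<Inter>?A" for K H
    using subsetD[OF sub that] by (simp add: inclusions_def)
  have 3: "(K \<inter> L, H \<inter> L) \<in> \<Inter>?A"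
    if "(K, H) \<in> \<Inter>?A" "subgroup L G" "L \<subseteq> H" for K H L
  proof (rule InterI)
    fix T assume T: "T \<in> ?A"
    have "(K, H) \<in> T" by (rule InterD[OF that(1) T])
    then show "(K \<inter> L, H \<inter> L) \<in> T"
      using ts[OF T] that(2,3) unfolding transfer_system_def by blast
  qed
  have 4: "(g <#\<^bsub>G\<^esub> K #>\<^bsub>G\<^esub> inv g, g <#\<^bsub>G\<^esub> H #>\<^bsub>G\<^esub> inv g) \<in> \<Inter>?A"
    if "(K, H) \<in> \<Inter>?A" "g \<in> carrier G" for K H g
  proof (rule InterI)
    fix T assume T: "T \<in> ?A"
    have "(K, H) \<in> T" by (rule InterD[OF that(1) T])
    then show "(g <#\<^bsub>G\<^esub> K #>\<^bsub>G\<^esub> inv g, g <#\<^bsub>G\<^esub> H #>\<^bsub>G\<^esub> inv g) \<in> T"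
      using ts[OF T] that(2) unfolding transfer_system_def by blast
  qed
  show ?thesis
    unfolding gen
    by (subst transfer_system_def, intro conjI allI ballI impI)
      (fact 1, erule 2, erule 3, assumption+, erule 4, assumption)
qed

lemma (in ring) subgroup_AGL1: "subgroup (carrier (AGL1 R)) (BijGroup (carrier R))"
proof -
  let ?f = "\<lambda>l m. \<lambda>x\<in>carrier R. l \<otimes> x \<oplus> m"
  have A: "carrier (AGL1 R) = {?f l m | l m. l \<in> Units R \<and> m \<in> carrier R}"
    by (simp add: AGL1_def)
  have comp: "compose (carrier R) (?f l m) (?f l' m') = ?f (l \<otimes> l') (l \<otimes> m' \<oplus> m)"
    if "l \<in> carrier R" "m \<in> carrier R" "l' \<in> carrier R" "m' \<in> carrier R" for l m l' m'
    using that by (auto simp: compose_def fun_eq_iff restrict_def r_distr m_assoc a_assoc)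
  have id: "?f \<one> \<zero> = (\<lambda>x\<in>carrier R. x)"
    by (auto simp: fun_eq_iff restrict_def)
  have invs: "compose (carrier R) (?f (inv l) (\<ominus> (inv l \<otimes> m))) (?f l m) = (\<lambda>x\<in>carrier R. x)"
             "compose (carrier R) (?f l m) (?f (inv l) (\<ominus> (inv l \<otimes> m))) = (\<lambda>x\<in>carrier R. x)"
    if "l \<in> Units R" "m \<in> carrier R" for l m
    using that
    by (simp_all add: comp id[symmetric] Units_closed r_minus m_assoc[symmetric] r_neg l_neg)
  have bij: "?f l m \<in> Bij (carrier R)" if "l \<in> Units R" "m \<in> carrier R" for l m
  proof -
    let ?g = "?f (inv l) (\<ominus> (inv l \<otimes> m))"
    have "?g (?f l m x) = x" "?f l m (?g x) = x" if "x \<in> carrier R" for x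
      using fun_cong[OF invs(1), of l m x] fun_cong[OF invs(2), of l m x] that \<open>l \<in> Units R\<close> \<open>m \<in> _\<close>
      by (simp_all add: compose_def Units_closed)
    then have "bij_betw (?f l m) (carrier R) (carrier R)"
      using that by (intro bij_betwI[where g = ?g]) (auto simp: Units_closed)
    then show ?thesis by (simp add: Bij_def)
  qed
  interpret B: group "BijGroup (carrier R)" by (rule group_BijGroup)
  show ?thesis
  proof (rule B.subgroupI)
    show "carrier (AGL1 R) \<subseteq> carrier (BijGroup (carrier R))"
      unfolding A using bij by (auto simp: BijGroup_def)
    show "carrier (AGL1 R) \<noteq> {}"
      unfolding A using Units_one_closed by blast
  next
    fix f assume "f \<in> carrier (AGL1 R)"
    then obtain l m where f: "f = ?f l m" and lm: "l \<in> Units R" "m \<in> carrier R"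
      unfolding A by blast
    let ?g = "?f (inv l) (\<ominus> (inv l \<otimes> m))"
    have g: "inv l \<in> Units R" "\<ominus> (inv l \<otimes> m) \<in> carrier R"
      using lm by auto
    have "inv\<^bsub>BijGroup (carrier R)\<^esub> f = ?g"
      unfolding f using invs(1)[OF lm] bij[OF lm] bij[OF g]
      by (intro B.inv_equality) (simp_all add: BijGroup_def)
    then show "inv\<^bsub>BijGroup (carrier R)\<^esub> f \<in> carrier (AGL1 R)"
      unfolding A using g by blast
  next
    fix f f' assume "f \<in> carrier (AGL1 R)" "f' \<in> carrier (AGL1 R)"
    then obtain l m l' m' where f: "f = ?f l m" "f' = ?f l' m'"
      and lm: "l \<in> Units R" "m \<in> carrier R" "l' \<in> Units R" "m' \<in> carrier R"
      unfolding A by blast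
    have "f \<otimes>\<^bsub>BijGroup (carrier R)\<^esub> f' = ?f (l \<otimes> l') (l \<otimes> m' \<oplus> m)"
      unfolding f using lm bij by (simp add: BijGroup_def comp Units_closed)
    moreover have "l \<otimes> l' \<in> Units R" "l \<otimes> m' \<oplus> m \<in> carrier R"
      using lm by (auto simp: Units_closed)
    ultimately show "f \<otimes>\<^bsub>BijGroup (carrier R)\<^esub> f' \<in> carrier (AGL1 R)"
      unfolding A by blast
  qed
qed

lemma (in ring) group_AGL1: "group (AGL1 R)"
proof -
  have "AGL1 R = BijGroup (carrier R)\<lparr>carrier := carrier (AGL1 R)\<rparr>"
    by (simp add: AGL1_def)
  then show ?thesis
    using subgroup.subgroup_is_group[OF subgroup_AGL1 group_BijGroup] by simp
qed

end

theory Submission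
  imports
    Defs
    "HOL-Number_Theory.Prime_Powers"
    "HOL-Algebra.Multiplicative_Group"
    "HOL-Algebra.Subrings"
begin

text \<open>A generating set of the complete transfer system must contain, for each proper subgroup \<open>M\<close>
  that is not an intersection of two larger subgroups, a pair whose first component is conjugate to
  \<open>M\<close>: removing all pairs below conjugates of \<open>M\<close> leaves a transfer system. Conversely the pairs
  \<open>(M, G)\<close> with one \<open>M\<close> from each class generate everything, because every subgroup is an
  intersection of such \<open>M\<close>. Hence the width is the number of conjugacy classes of meet-irreducible
  subgroups.

  In \<open>AGL(1, q)\<close> the meet-irreducible subgroups containing all translations correspond to the
  subgroups of prime power index greater than 1 in the cyclic group of units of the field. The
  others are, up to conjugation, the semidirect products of \<open>V\<close> with \<open>K - {0}\<close> where \<open>K\<close> is a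
  subfield and \<open>V\<close> a \<open>K\<close>-hyperplane of the field: the linear parts of such a subgroup exhaust the
  stabilizer of its translation part \<open>V\<close>, and this stabilizer (with 0) is a subfield. All
  \<open>K\<close>-hyperplanes are multiples of each other, so each subfield gives one class.\<close>

section \<open>Width and meet-irreducible subgroups\<close>

text \<open>Deleting the pairs below conjugates of \<open>M\<close> respects restriction exactly
  because \<open>K \<inter> L = M\<close> forces \<open>K = M\<close> or \<open>L = M\<close>.

  The main obstacle in the affine group is that a subgroup need not contain the linear maps x -> l x
  for its linear parts l. The linear parts form a cyclic group; a lift of a generator other than 1
  has a fixed point, and the translation moving that point to zero conjugates the subgroup into a
  semidirect product of some D and V. If K is the stabilizer of V, this product is the intersection
  of the product of \<open>K - {\<zero>}\<close> with V and the product of D with the whole field.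
  Meet-irreducibility therefore leaves only two cases: V is everything, or D is all of
  \<open>K - {\<zero>}\<close>.

  Both terms of the formula rest on the unit group being cyclic of order N = p^n - 1. Its subgroups
  are sets of roots of unity, one for each divisor of N, and the prime powers dividing N number
  Omega(N). A subfield is recognised by its units, so subfields correspond to the divisors of n.
  That any two hyperplanes are proportional is obtained by counting, in place of duality.\<close>

definition meet_irreducible :: "('a, 'b) monoid_scheme \<Rightarrow> 'a set \<Rightarrow> bool" where
  "meet_irreducible G M \<longleftrightarrow> subgroup M G \<and> M \<noteq> carrier G \<and>
     (\<forall>A B. subgroup A G \<longrightarrow> subgroup B G \<longrightarrow> A \<inter> B = M \<longrightarrow> A = M \<or> B = M)"

definition conjugate :: "('a, 'b) monoid_scheme \<Rightarrow> 'a \<Rightarrow> 'a set \<Rightarrow> 'a set" where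
  "conjugate G g H = g <#\<^bsub>G\<^esub> H #>\<^bsub>G\<^esub> inv\<^bsub>G\<^esub> g"

context group
begin

lemma conjugate_eq_image: "conjugate G g H = (\<lambda>h. g \<otimes> h \<otimes> inv g) ` H"
  by (auto simp: conjugate_def l_coset_def r_coset_def)

lemma subgroup_conjugateI:
  "subgroup H G \<Longrightarrow> g \<in> carrier G \<Longrightarrow> subgroup (conjugate G g H) G"
  unfolding conjugate_def by (rule subgroup_conjugate)

lemma conjugate_conjugate:
  assumes "g \<in> carrier G" "h \<in> carrier G" "H \<subseteq> carrier G"
  shows "conjugate G g (conjugate G h H) = conjugate G (g \<otimes> h) H"
  unfolding conjugate_eq_image image_image
  using assms by (intro image_cong) (auto simp: inv_mult_group m_assoc subset_iff)

lemma conjugate_one: "H \<subseteq> carrier G \<Longrightarrow> conjugate G \<one> H = H"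
  unfolding conjugate_eq_image by (auto simp: image_iff subset_iff)

lemma conjugate_inv_conjugate:
  assumes "g \<in> carrier G" "H \<subseteq> carrier G"
  shows "conjugate G (inv g) (conjugate G g H) = H"
  using conjugate_conjugate[of "inv g" g H] assms by (simp add: conjugate_one)

lemma conjugate_carrier:
  assumes "g \<in> carrier G"
  shows "conjugate G g (carrier G) = carrier G"
proof
  show "conjugate G g (carrier G) \<subseteq> carrier G"
    using assms by (auto simp: conjugate_eq_image)
  then have "conjugate G (inv g) (carrier G) \<subseteq> carrier G"
    using assms unfolding conjugate_eq_image by auto
  then have "conjugate G g (conjugate G (inv g) (carrier G)) \<subseteq> conjugate G g (carrier G)"
    unfolding conjugate_eq_image[of g] by (rule image_mono)
  then show "carrier G \<subseteq> conjugate G g (carrier G)"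
    using conjugate_conjugate[of g "inv g" "carrier G"] assms by (simp add: conjugate_one)
qed

lemma conjugate_Int:
  assumes "g \<in> carrier G" "H \<subseteq> carrier G" "K \<subseteq> carrier G"
  shows "conjugate G g (H \<inter> K) = conjugate G g H \<inter> conjugate G g K"
  unfolding conjugate_eq_image using assms
  by (intro inj_on_image_Int[of _ "carrier G"] inj_onI) (auto simp: subset_iff)

lemma meet_irreducible_conjugate:
  assumes M: "meet_irreducible G M" and g: "g \<in> carrier G"
  shows "meet_irreducible G (conjugate G g M)"
  unfolding meet_irreducible_def
proof (intro conjI allI impI)
  have M': "subgroup M G" "M \<subseteq> carrier G" "M \<noteq> carrier G"
    using M subgroup.subset by (auto simp: meet_irreducible_def)
  show "subgroup (conjugate G g M) G" using M' g by (simp add: subgroup_conjugateI)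
  show "conjugate G g M \<noteq> carrier G"
    using conjugate_inv_conjugate[OF g M'(2)] conjugate_carrier[OF inv_closed[OF g]] M'(3) by metis
  fix A B assume AB: "subgroup A G" "subgroup B G" "A \<inter> B = conjugate G g M"
  have sub: "A \<subseteq> carrier G" "B \<subseteq> carrier G" using AB subgroup.subset by auto
  have "conjugate G (inv g) A \<inter> conjugate G (inv g) B = M"
    using conjugate_Int[of "inv g" A B] AB(3) conjugate_inv_conjugate[OF g M'(2)] g sub by simp
  then have "conjugate G (inv g) A = M \<or> conjugate G (inv g) B = M"
    using M AB g by (simp add: meet_irreducible_def subgroup_conjugateI)
  then show "A = conjugate G g M \<or> B = conjugate G g M"
    using conjugate_inv_conjugate[OF inv_closed[OF g]] inv_inv[OF g] sub by metis
qed

lemma generating_set_contains_meet_irreducible: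
  assumes M: "meet_irreducible G M" and S: "S \<subseteq> inclusions G"
    and gen: "generated_transfer_system G S = inclusions G"
  shows "\<exists>g\<in>carrier G. conjugate G g M \<in> fst ` S"
proof (rule ccontr)
  assume no: "\<not> ?thesis"
  define C where "C = {conjugate G g M | g. g \<in> carrier G}"
  \<comment> \<open>Only proper pairs are deleted; the pairs (K, K) stay, so reflexivity
    survives.\<close>
  let ?T = "inclusions G - {(K, L). K \<in> C \<and> L \<noteq> K}"
  have irr: "meet_irreducible G K" if "K \<in> C" for K
    using that M meet_irreducible_conjugate unfolding C_def by blast
  have Msub: "M \<subseteq> carrier G" "subgroup M G" "M \<noteq> carrier G"
    using M subgroup.subset by (auto simp: meet_irreducible_def)
  have Cconj: "conjugate G h K \<in> C \<longleftrightarrow> K \<in> C" if h: "h \<in> carrier G" and K: "K \<subseteq> carrier G" for h K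
  proof
    assume "conjugate G h K \<in> C"
    then obtain g where g: "g \<in> carrier G" "conjugate G h K = conjugate G g M" unfolding C_def by blast
    then have "K = conjugate G (inv h \<otimes> g) M"
      using conjugate_inv_conjugate[OF h K] conjugate_conjugate[of "inv h" g M] h Msub by simp
    then show "K \<in> C" using g h unfolding C_def by blast
  next
    assume "K \<in> C"
    then obtain g where g: "g \<in> carrier G" "K = conjugate G g M" unfolding C_def by blast
    then have "conjugate G h K = conjugate G (h \<otimes> g) M"
      using h Msub by (simp add: conjugate_conjugate)
    then show "conjugate G h K \<in> C" using g h unfolding C_def by blast
  qed
  have inc: "transfer_system G (inclusions G)" by (rule transfer_system_inclusions)
  have "transfer_system G ?T"
    unfolding transfer_system_def conjugate_def[symmetric]
  proof (intro conjI allI ballI impI)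
    show "partial_order_on {H. subgroup H G} ?T"
      unfolding partial_order_on_def preorder_on_def
    proof (intro conjI)
      show "refl_on {H. subgroup H G} ?T" by (auto simp: refl_on_def inclusions_def)
      show "?T \<subseteq> {H. subgroup H G} \<times> {H. subgroup H G}" by (auto simp: inclusions_def)
      \<comment> \<open>If a chain starts in \<open>C\<close>, both of its pairs are trivial, hence
        so is the composite.\<close>
      show "trans ?T" by (rule transI) (auto simp: inclusions_def)
      show "antisym ?T" by (rule antisymI) (auto simp: inclusions_def)
    qed
  next
    fix K H assume "(K, H) \<in> ?T" then show "K \<subseteq> H" by (auto simp: inclusions_def)
  next
    fix K H L assume KH: "(K, H) \<in> ?T" and L: "subgroup L G" "L \<subseteq> H"
    have 1: "(K \<inter> L, H \<inter> L) \<in> inclusions G"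
      using KH L inc unfolding transfer_system_def by blast
    have K: "subgroup K G" "K \<subseteq> H" using KH by (auto simp: inclusions_def)
    \<comment> \<open>Meet-irreducibility of \<open>K \<inter> L\<close> leaves two cases:
      \<open>K\<close> itself is in \<open>C\<close>, so (K, H) is trivial, or
      \<open>L \<subseteq> K\<close>, and both restrictions equal \<open>L\<close>.\<close>
    have "H \<inter> L = K \<inter> L" if C: "K \<inter> L \<in> C"
    proof -
      have "K = K \<inter> L \<or> L = K \<inter> L"
        using irr[OF C] K L by (simp add: meet_irreducible_def)
      then show ?thesis
      proof
        assume "K = K \<inter> L"
        then have "K \<in> C" using C by simp
        then have "H = K" using KH by blast
        then show ?thesis by simp
      qed (use L in blast)
    qed
    then show "(K \<inter> L, H \<inter> L) \<in> ?T" using 1 by blast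
  next
    fix K H g assume g: "g \<in> carrier G" and KH: "(K, H) \<in> ?T"
    have 1: "(conjugate G g K, conjugate G g H) \<in> inclusions G"
      using KH g inc unfolding transfer_system_def conjugate_def by blast
    have K: "K \<subseteq> carrier G" using KH subgroup.subset by (auto simp: inclusions_def)
    have "conjugate G g H = conjugate G g K" if "conjugate G g K \<in> C"
    proof -
      have "K \<in> C" using that Cconj[OF g K] by simp
      then show ?thesis using KH by blast
    qed
    then show "(conjugate G g K, conjugate G g H) \<in> ?T" using 1 by blast
  qed
  moreover have "S \<subseteq> ?T"
  proof (rule subsetI)
    fix x assume x: "x \<in> S"
    then have "fst x \<notin> C" using no unfolding C_def by blast
    then show "x \<in> ?T" using S x by auto
  qed
  ultimately have "inclusions G \<subseteq> ?T"
    using gen unfolding generated_transfer_system_def by blast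
  moreover have "(M, carrier G) \<in> inclusions G"
    using Msub subgroup_self by (simp add: inclusions_def)
  moreover have "M \<in> C" using conjugate_one[OF Msub(1)] one_closed unfolding C_def by blast
  ultimately show False using Msub(3) by blast
qed

text \<open>Induction downwards from G: if \<open>H = A \<inter> B\<close> with \<open>A\<close>,
  \<open>B\<close> larger, restricting (A, G) to \<open>B\<close> gives (H, B), and transitivity
  with (B, G) gives (H, G). Restricting (K, G) to an overgroup of \<open>K\<close> then yields every
  inclusion.\<close>

lemma transfer_system_contains_inclusions:
  assumes fin: "finite (carrier G)" and T: "transfer_system G T"
    and irr: "\<And>M. meet_irreducible G M \<Longrightarrow> (M, carrier G) \<in> T"
  shows "inclusions G \<subseteq> T"
proof -
  have refl: "(H, H) \<in> T" if "subgroup H G" for H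
    using T that by (auto simp: transfer_system_def partial_order_on_def preorder_on_def refl_on_def)
  have trans: "trans T"
    using T by (auto simp: transfer_system_def partial_order_on_def preorder_on_def)
  have restrict: "(K \<inter> L, L) \<in> T" if "(K, carrier G) \<in> T" "subgroup L G" for K L
  proof -
    have "L \<subseteq> carrier G" using that subgroup.subset by auto
    then have "(K \<inter> L, carrier G \<inter> L) \<in> T" "carrier G \<inter> L = L"
      using T that unfolding transfer_system_def by blast+
    then show ?thesis by simp
  qed
  have top: "(H, carrier G) \<in> T" if "subgroup H G" for H
    using that
  proof (induction "card (carrier G) - card H" arbitrary: H rule: less_induct)
    case less
    have smaller: "card (carrier G) - card A < card (carrier G) - card H"
      if "subgroup A G" "H \<subset> A" for A
    proof -
      have "A \<subseteq> carrier G" using that(1) subgroup.subset by auto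
      then show ?thesis
        using psubset_card_mono[of A H] card_mono[of "carrier G" A] fin that(2)
        by (meson diff_less_mono2 finite_subset order_less_le_trans)
    qed
    show ?case
    proof (cases "H = carrier G \<or> meet_irreducible G H")
      case True
      then show ?thesis using irr refl subgroup_self by auto
    next
      case False
      then obtain A B where AB: "subgroup A G" "subgroup B G" "A \<inter> B = H" "A \<noteq> H" "B \<noteq> H"
        using less.prems by (auto simp: meet_irreducible_def)
      then have "(A, carrier G) \<in> T" "(B, carrier G) \<in> T"
        using smaller by (auto intro!: less.hyps)
      then show ?thesis using restrict[of A B] AB transD[OF trans] by blast
    qed
  qed
  show ?thesis
  proof clarify
    fix K H assume "(K, H) \<in> inclusions G"
    then have "subgroup K G" "subgroup H G" "K \<inter> H = K" by (auto simp: inclusions_def)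
    then show "(K, H) \<in> T" using restrict[OF top, of K H] by simp
  qed
qed

text \<open>\<open>f\<close> is any complete conjugacy invariant on meet-irreducible subgroups.
  Counting its values stands in for counting conjugacy classes and lets a concrete invariant be
  enumerated later.\<close>

theorem width_eq_card_meet_irreducible_classes:
  assumes fin: "finite (carrier G)"
    and inv: "\<And>A B. meet_irreducible G A \<Longrightarrow> meet_irreducible G B \<Longrightarrow>
                f A = f B \<longleftrightarrow> (\<exists>g\<in>carrier G. B = conjugate G g A)"
  shows "width G = card (f ` {M. meet_irreducible G M})"
proof -
  let ?I = "{M. meet_irreducible G M}"
  have "?I \<subseteq> Pow (carrier G)" using subgroup.subset by (auto simp: meet_irreducible_def)
  then have finI: "finite ?I" using fin by (metis finite_Pow_iff finite_subset)
  \<comment> \<open>One representative for each value of \<open>f\<close>; its pair with G goes into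
    the generating set.\<close>
  let ?r = "\<lambda>y. SOME M. M \<in> ?I \<and> f M = y"
  have r: "?r y \<in> ?I" "f (?r y) = y" if "y \<in> f ` ?I" for y
  proof -
    have "\<exists>M. M \<in> ?I \<and> f M = y" using that by blast
    from someI_ex[OF this] show "?r y \<in> ?I" "f (?r y) = y" by auto
  qed
  let ?S = "(\<lambda>y. (?r y, carrier G)) ` f ` ?I"
  have "inj_on (\<lambda>y. (?r y, carrier G)) (f ` ?I)"
    by (rule inj_on_inverseI[where g = "\<lambda>x. f (fst x)"]) (use r(2) in simp)
  then have cardS: "card ?S = card (f ` ?I)" by (rule card_image)
  have Sinc: "?S \<subseteq> inclusions G"
  proof clarify
    fix M assume "meet_irreducible G M"
    then have "meet_irreducible G (?r (f M))" using r(1)[of "f M"] by blast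
    then have "subgroup (?r (f M)) G" by (simp add: meet_irreducible_def)
    then show "(?r (f M), carrier G) \<in> inclusions G"
      using subgroup_self subgroup.subset by (simp add: inclusions_def)
  qed
  have gen: "generated_transfer_system G ?S = inclusions G"
  proof
    show "generated_transfer_system G ?S \<subseteq> inclusions G"
      using Sinc transfer_system_inclusions unfolding generated_transfer_system_def by blast
    have "inclusions G \<subseteq> T" if T: "transfer_system G T" "?S \<subseteq> T" for T
    proof (rule transfer_system_contains_inclusions[OF fin T(1)])
      fix M assume M: "meet_irreducible G M"
      then have y: "f M \<in> f ` ?I" by blast
      obtain g where g: "g \<in> carrier G" "M = conjugate G g (?r (f M))"
        using inv[of "?r (f M)" M] r[OF y] M by auto
      \<comment> \<open>Conjugation fixes the top group, so the pair of a representative yields the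
        pair of every conjugate.\<close>
      have "(?r (f M), carrier G) \<in> T" using T(2) y by blast
      then have "(conjugate G g (?r (f M)), conjugate G g (carrier G)) \<in> T"
        using T(1) g(1) unfolding transfer_system_def conjugate_def by blast
      then show "(M, carrier G) \<in> T" using g(1) g(2)[symmetric] conjugate_carrier by simp
    qed
    then show "inclusions G \<subseteq> generated_transfer_system G ?S"
      unfolding generated_transfer_system_def by blast
  qed
  have lower: "card (f ` ?I) \<le> card S"
    if S: "S \<subseteq> inclusions G" "finite S" "generated_transfer_system G S = inclusions G" for S
  proof -
    \<comment> \<open>Some conjugate of each meet-irreducible \<open>M\<close> is a first component
      in \<open>S\<close>, and \<open>f\<close> does not see the conjugation.\<close>
    have "f ` ?I \<subseteq> f ` fst ` S"
    proof clarify
      fix M assume M: "meet_irreducible G M"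
      then obtain g where g: "g \<in> carrier G" "conjugate G g M \<in> fst ` S"
        using generating_set_contains_meet_irreducible S by blast
      have "f M = f (conjugate G g M)"
        using inv[OF M meet_irreducible_conjugate[OF M g(1)]] g(1) by blast
      then show "f M \<in> f ` fst ` S" using g(2) by simp
    qed
    then have "card (f ` ?I) \<le> card (f ` fst ` S)" using S(2) by (intro card_mono) auto
    also have "\<dots> \<le> card S"
      using S(2) card_image_le[of "fst ` S" f] card_image_le[of S fst] by simp
    finally show ?thesis .
  qed
  show ?thesis
    unfolding width_def
  proof (rule Least_equality)
    show "\<exists>S\<subseteq>inclusions G. finite S \<and> card S = card (f ` ?I) \<and>
            generated_transfer_system G S = inclusions G"
      using Sinc finI cardS gen by (intro exI[of _ ?S]) auto
    fix k assume "\<exists>S\<subseteq>inclusions G. finite S \<and> card S = k \<and>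
            generated_transfer_system G S = inclusions G"
    then show "card (f ` ?I) \<le> k" using lower by blast
  qed
qed

end

section \<open>Arithmetic and the binomial theorem\<close>

text \<open>Sending a prime power to its prime hits each prime once for every exponent from 1 to its
  multiplicity in \<open>m\<close>, which gives the multiset of prime factors.\<close>

lemma card_primepow_factors:
  fixes m :: nat
  assumes "m > 0"
  shows "card {q. primepow q \<and> q dvd m} = size (prime_factorization m)"
proof -
  have "size (prime_factorization m) = size (image_mset aprimedivisor (mset_set (primepow_factors m)))"
    using aprimedivisor_primepow_factors_conv_prime_factorization[of m] assms by simp
  then show ?thesis by (simp add: primepow_factors_def)
qed

text \<open>One step of the subtractive Euclidean algorithm on exponents: for n = m + d, p^n - 1 =
  p^m (p^d - 1) + (p^m - 1), so \<open>n\<close> may be replaced by \<open>n - d\<close>.\<close>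

lemma power_minus_one_dvd_iff:
  fixes p d n :: nat
  assumes p: "p \<ge> 2" and d: "d \<ge> 1"
  shows "p ^ d - 1 dvd p ^ n - 1 \<longleftrightarrow> d dvd n"
proof (induction n rule: less_induct)
  case (less n)
  show ?case
  proof (cases "n < d")
    case True
    have *: "p ^ n < p ^ d" "p ^ n \<ge> 1" using True p by (simp_all add: power_strict_increasing)
    have "p ^ d - 1 dvd p ^ n - 1 \<longleftrightarrow> p ^ n = 1"
    proof
      assume "p ^ d - 1 dvd p ^ n - 1"
      then have "p ^ n - 1 = 0" using * dvd_imp_le[of "p ^ d - 1" "p ^ n - 1"] by linarith
      then show "p ^ n = 1" using * by linarith
    next
      assume "p ^ n = 1"
      then show "p ^ d - 1 dvd p ^ n - 1" by (simp only: diff_self_eq_0 dvd_0_right)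
    qed
    also have "\<dots> \<longleftrightarrow> n = 0" using p by simp
    also have "\<dots> \<longleftrightarrow> d dvd n" using True dvd_imp_le[of d n] by (cases "n = 0") auto
    finally show ?thesis .
  next
    case False
    define m where "m = n - d"
    have n: "n = m + d" using False by (simp add: m_def)
    have "p ^ m \<ge> 1" "p ^ d \<ge> 1" using p by simp_all
    then have eq: "p ^ n - 1 = p ^ m * (p ^ d - 1) + (p ^ m - 1)"
      by (simp add: n power_add diff_mult_distrib2)
    have "p ^ d - 1 dvd p ^ n - 1 \<longleftrightarrow> p ^ d - 1 dvd p ^ m - 1"
      unfolding eq by (simp add: dvd_add_right_iff)
    also have "\<dots> \<longleftrightarrow> d dvd m" using less n d by simp
    also have "\<dots> \<longleftrightarrow> d dvd n" by (simp add: n)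
    finally show ?thesis .
  qed
qed

text \<open>With \<open>coprime_dvd_primepow\<close> this turns meet-irreducibility into arithmetic:
  in a cyclic group, overgroups of a subgroup of index \<open>m\<close> correspond to divisors of
  \<open>m\<close>, and coprime divisors to overgroups meeting in it.\<close>

lemma not_primepow_coprime_factors:
  fixes m :: nat
  assumes "m > 1" "\<not> primepow m"
  shows "\<exists>a b. m = a * b \<and> coprime a b \<and> a > 1 \<and> b > 1"
proof -
  obtain r where r: "prime r" "r dvd m" using assms prime_factor_nat[of m] by auto
  obtain b where b: "m = r ^ multiplicity r m * b" "\<not> r dvd b"
    using multiplicity_decompose'[of m r] assms(1) prime_gt_1_nat[OF r(1)] by auto
  have pos: "multiplicity r m > 0" using r assms by (simp add: prime_multiplicity_gt_zero_iff)
  have "b \<noteq> 0" using b(2) by (metis dvd_0_right)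
  moreover have "b \<noteq> 1"
  proof
    assume "b = 1"
    then have "m = r ^ multiplicity r m" using b by simp
    then have "primepow m" using pos r unfolding primepow_def by blast
    then show False using assms by simp
  qed
  ultimately have "b > 1" by simp
  moreover have "r ^ multiplicity r m > 1" using pos prime_gt_1_nat[OF r(1)] by (rule one_less_power[rotated])
  moreover have "coprime (r ^ multiplicity r m) b"
    using b(2) r(1) by (simp add: prime_imp_coprime)
  ultimately show ?thesis using b(1) by blast
qed

lemma coprime_dvd_primepow:
  fixes a b q :: nat
  assumes "primepow q" "a dvd q" "b dvd q" "coprime a b"
  shows "a = 1 \<or> b = 1"
proof -
  obtain r k where r: "prime r" "q = r ^ k" using assms(1) unfolding primepow_def by blast
  obtain i j where "a = r ^ i" "b = r ^ j"
    using assms(2,3) divides_primepow_nat[OF r(1)] unfolding r(2) by auto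
  then show ?thesis using assms(4) r(1) by (cases i; cases j) auto
qed

section \<open>Binomial theorem and additivity of Frobenius powers\<close>

context cring
begin

lemma binomial_ring:
  assumes [simp]: "x \<in> carrier R" "y \<in> carrier R"
  shows "(x \<oplus> y) [^] (n::nat) = (\<Oplus>k\<in>{..n}. [(n choose k)] \<cdot> (x [^] k \<otimes> y [^] (n - k)))"
proof (induction n)
  case 0
  show ?case by simp
next
  case (Suc n)
  let ?S = "\<Oplus>k\<in>{..n}. [(n choose k)] \<cdot> (x [^] k \<otimes> y [^] (n - k))"
  let ?g = "\<lambda>k. [(n choose k)] \<cdot> (x [^] k \<otimes> y [^] (Suc n - k))"
  let ?A = "\<Oplus>k\<in>{..n}. [(n choose k)] \<cdot> (x [^] Suc k \<otimes> y [^] (n - k))"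
  let ?B = "\<Oplus>k\<in>{..n}. [(n choose Suc k)] \<cdot> (x [^] Suc k \<otimes> y [^] (n - k))"
  \<comment> \<open>Allows the sum for \<open>y \<otimes> ?S\<close> to be extended to the index
    \<open>Suc n\<close> and then shifted, so that Pascal's rule combines it with \<open>?A\<close>
    term by term.\<close>
  have [simp]: "n choose Suc n = 0" by (simp add: binomial_eq_0)
  have "x \<otimes> ?S = (\<Oplus>k\<in>{..n}. x \<otimes> ([(n choose k)] \<cdot> (x [^] k \<otimes> y [^] (n - k))))"
    by (rule finsum_rdistr) auto
  also have "\<dots> = ?A"
    by (rule finsum_cong') (auto simp: add_pow_rdistr m_ac)
  finally have xS: "x \<otimes> ?S = ?A" .
  have "y \<otimes> ?S = (\<Oplus>k\<in>{..n}. y \<otimes> ([(n choose k)] \<cdot> (x [^] k \<otimes> y [^] (n - k))))"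
    by (rule finsum_rdistr) auto
  also have "\<dots> = (\<Oplus>k\<in>{..n}. ?g k)"
    by (rule finsum_cong') (auto simp: add_pow_rdistr m_ac Suc_diff_le)
  also have "\<dots> = (\<Oplus>k\<in>{..Suc n}. ?g k)"
    by (subst finsum_Suc) auto
  also have "\<dots> = ?B \<oplus> y [^] Suc n"
    by (subst finsum_Suc2) auto
  finally have yS: "y \<otimes> ?S = ?B \<oplus> y [^] Suc n" .
  have "(\<Oplus>k\<in>{..Suc n}. [(Suc n choose k)] \<cdot> (x [^] k \<otimes> y [^] (Suc n - k)))
      = (\<Oplus>k\<in>{..n}. [(Suc n choose Suc k)] \<cdot> (x [^] Suc k \<otimes> y [^] (n - k))) \<oplus> y [^] Suc n"
    by (subst finsum_Suc2) auto
  also have "(\<Oplus>k\<in>{..n}. [(Suc n choose Suc k)] \<cdot> (x [^] Suc k \<otimes> y [^] (n - k)))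
      = (\<Oplus>k\<in>{..n}. [(n choose k)] \<cdot> (x [^] Suc k \<otimes> y [^] (n - k)) \<oplus>
                    [(n choose Suc k)] \<cdot> (x [^] Suc k \<otimes> y [^] (n - k)))"
    by (rule finsum_cong') (auto simp: add.nat_pow_mult)
  also have "\<dots> = ?A \<oplus> ?B"
    by (rule finsum_addf) auto
  also have "?A \<oplus> ?B \<oplus> y [^] Suc n = x \<otimes> ?S \<oplus> y \<otimes> ?S"
    unfolding xS yS by (rule a_assoc) auto
  also have "\<dots> = (x \<oplus> y) \<otimes> ?S"
    by (rule l_distr[symmetric]) auto
  also have "\<dots> = (x \<oplus> y) [^] Suc n"
    unfolding Suc.IH[symmetric] by (subst nat_pow_Suc) (rule m_comm; simp)
  finally show ?case by (rule sym)
qed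

lemma frobenius_add:
  assumes p: "prime p" "[p] \<cdot> \<one> = \<zero>" and [simp]: "x \<in> carrier R" "y \<in> carrier R"
  shows "(x \<oplus> y) [^] (p ^ d :: nat) = x [^] (p ^ d) \<oplus> y [^] (p ^ d)"
proof -
  have char: "[(p * k)] \<cdot> z = \<zero>" if "z \<in> carrier R" for k z
  proof -
    have "[p] \<cdot> z = [p] \<cdot> \<one> \<otimes> z" using that by (simp add: add_pow_ldistr)
    then have "[p] \<cdot> z = \<zero>" using p(2) that by simp
    then have "[k] \<cdot> ([p] \<cdot> z) = \<zero>" by simp
    then show ?thesis using that by (simp add: add.nat_pow_pow)
  qed
  \<comment> \<open>With p = m + 2 the inner terms are those of index \<open>Suc k\<close> with
    \<open>k \<le> m\<close>, whose binomial coefficients are divisible by \<open>p\<close>.\<close>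
  obtain m where m: "p = Suc (Suc m)"
    using prime_ge_2_nat[OF p(1)] by (intro that[of "p - 2"]) simp
  have one: "(x \<oplus> y) [^] p = x [^] p \<oplus> y [^] p"
    if [simp]: "x \<in> carrier R" "y \<in> carrier R" for x y
  proof -
    let ?f = "\<lambda>k. [(p choose k)] \<cdot> (x [^] k \<otimes> y [^] (p - k))"
    have "(x \<oplus> y) [^] p = (\<Oplus>k\<in>{..Suc (Suc m)}. ?f k)"
      using binomial_ring[of x y p] by (simp add: m)
    also have "\<dots> = ?f (Suc (Suc m)) \<oplus> ((\<Oplus>k\<in>{..m}. ?f (Suc k)) \<oplus> ?f 0)"
      by (subst finsum_Suc, simp, subst finsum_Suc2) auto
    also have "(\<Oplus>k\<in>{..m}. ?f (Suc k)) = \<zero>"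
    proof (rule add.finprod_one_eqI)
      fix k assume "k \<in> {..m}"
      then have "p dvd (p choose Suc k)" using p(1) m by (intro dvd_choose_prime) auto
      then obtain j where "p choose Suc k = p * j" by (elim dvdE)
      then show "?f (Suc k) = \<zero>" using char by simp
    qed
    finally show ?thesis by (simp add: m)
  qed
  show ?thesis
  proof (induction d)
    case (Suc d)
    then show ?case by (simp add: one nat_pow_pow[symmetric] mult.commute[of p])
  qed simp
qed

end

section \<open>Finite fields, their subfields and hyperplanes\<close>

locale finite_field = field +
  assumes finite_carrier: "finite (carrier R)"
begin

text \<open>Excluding zero matters for \<open>e = 0\<close>, where every element has power 1: the
  set is then all units, a subgroup for every \<open>e\<close>.\<close>

definition unity_roots :: "nat \<Rightarrow> 'a set" where
  "unity_roots e = {x \<in> carrier R - {\<zero>}. x [^] e = \<one>}"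

lemma order_gt_one: "card (carrier R) > 1"
  using card_mono[OF finite_carrier, of "{\<zero>, \<one>}"] by simp

lemma inv_nonzero:
  assumes "a \<in> carrier R" "a \<noteq> \<zero>"
  shows "inv a \<in> carrier R" "inv a \<noteq> \<zero>" "inv a \<otimes> a = \<one>" "a \<otimes> inv a = \<one>"
  using subfield_m_inv[OF carrier_is_subfield, of a] assms by auto

text \<open>If \<open>a\<close> generates the units and their number is e k, the witness is a^k. The
  list of its powers serves twice: it counts the roots of unity, and it supplies a generator for the
  linear parts of a subgroup.\<close>

lemma unity_roots_cyclic:
  assumes e: "e dvd card (carrier R) - 1"
  obtains b where "b \<in> carrier R" "inj_on (\<lambda>j::nat. b [^] j) {..<e}"
    "unity_roots e = (\<lambda>j. b [^] j) ` {..<e}"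
proof -
  interpret G: group "mult_of R" rewrites
      "([^]\<^bsub>mult_of R\<^esub>) = (([^]) :: _ \<Rightarrow> nat \<Rightarrow> _)" and "\<one>\<^bsub>mult_of R\<^esub> = \<one>"
    by (rule field_mult_group) (simp_all add: fun_eq_iff nat_pow_def)
  let ?N = "card (carrier R) - 1"
  have Npos: "?N > 0" using order_gt_one by simp
  have fin: "finite (carrier (mult_of R))" using finite_carrier by simp
  obtain a where a: "a \<in> carrier (mult_of R)" "carrier (mult_of R) = {a [^] i | i::nat. i \<in> UNIV}"
    using finite_field_mult_group_has_gen[OF finite_carrier] by blast
  have elems: "carrier (mult_of R) = (\<lambda>i. a [^] i) ` {0..G.ord a - 1}"
    using a(2) G.ord_elems[OF fin a(1)] by auto
  have "card (carrier (mult_of R)) = G.ord a"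
    unfolding elems card_image[OF G.ord_inj[OF a(1)]] using G.ord_ge_1[OF fin a(1)] by simp
  then have ord: "G.ord a = ?N" using finite_carrier by simp
  obtain k where k: "?N = e * k" using e by (elim dvdE)
  have pos: "e > 0" "k > 0" using k Npos by auto
  have aR: "a \<in> carrier R" using a(1) by simp
  \<comment> \<open>Keeps the exponents in the range below the order of \<open>a\<close>, where its
    powers are distinct.\<close>
  have less: "k * j \<le> ?N - 1" if "j < e" for j
  proof -
    have "k * j < k * e" using that pos by simp
    then have "k * j < ?N" by (simp only: k mult.commute)
    then show ?thesis by linarith
  qed
  show thesis
  proof (rule that[of "a [^] k"])
    show "a [^] k \<in> carrier R" using aR by simp
    show "inj_on (\<lambda>j. (a [^] k) [^] j) {..<e}"
    proof (rule inj_onI)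
      fix i j assume ij: "i \<in> {..<e}" "j \<in> {..<e}" "(a [^] k) [^] i = (a [^] k) [^] j"
      then have "k * i = k * j"
        using inj_onD[OF G.ord_inj[OF a(1)], of "k * i" "k * j"] less[of i] less[of j] aR
        by (simp add: nat_pow_pow ord)
      then show "i = j" using pos by simp
    qed
    show "unity_roots e = (\<lambda>j. (a [^] k) [^] j) ` {..<e}"
    proof
      show "unity_roots e \<subseteq> (\<lambda>j. (a [^] k) [^] j) ` {..<e}"
      proof
        fix x assume x: "x \<in> unity_roots e"
        then have "x \<in> carrier (mult_of R)" by (simp add: unity_roots_def)
        then obtain i where i: "i \<in> {0..?N - 1}" "x = a [^] i"
          unfolding elems ord by blast
        have "a [^] (i * e) = \<one>" using x i aR by (simp add: unity_roots_def nat_pow_pow)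
        then have "e * k dvd i * e" using G.pow_eq_id[OF a(1)] ord k by simp
        then have "k dvd i" using pos by (simp add: mult.commute)
        then obtain j where j: "i = k * j" by (elim dvdE)
        have "i < ?N" using i(1) Npos by (simp only: atLeastAtMost_iff) linarith
        then have "k * j < k * e" by (simp only: j k mult.commute)
        then have "j < e" by simp
        then show "x \<in> (\<lambda>j. (a [^] k) [^] j) ` {..<e}"
          using i(2) j aR by (auto simp: nat_pow_pow)
      qed
      show "(\<lambda>j. (a [^] k) [^] j) ` {..<e} \<subseteq> unity_roots e"
      proof clarify
        fix j
        have "(a [^] (k * j)) [^] e = (a [^] ?N) [^] j"
          using aR by (simp only: nat_pow_pow k mult_ac)
        also have "a [^] ?N = \<one>" using G.pow_eq_id[OF a(1)] ord by simp
        finally have "(a [^] (k * j)) [^] e = \<one>" by simp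
        moreover have "a [^] (k * j) \<in> carrier (mult_of R)" using G.nat_pow_closed[OF a(1)] .
        ultimately show "(a [^] k) [^] j \<in> unity_roots e"
          using aR by (simp add: unity_roots_def nat_pow_pow)
      qed
    qed
  qed
qed

lemma card_unity_roots:
  assumes "e dvd card (carrier R) - 1"
  shows "card (unity_roots e) = e"
  using unity_roots_cyclic[OF assms] by (metis card_image card_lessThan)

text \<open>An exponent kills \<open>x\<close> iff the order of \<open>x\<close> divides it, and
  dividing \<open>d\<close> and \<open>e\<close> means dividing their gcd.\<close>

lemma unity_roots_Int: "unity_roots d \<inter> unity_roots e = unity_roots (gcd d e)"
proof -
  interpret G: group "mult_of R" rewrites
      "([^]\<^bsub>mult_of R\<^esub>) = (([^]) :: _ \<Rightarrow> nat \<Rightarrow> _)" and "\<one>\<^bsub>mult_of R\<^esub> = \<one>"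
    by (rule field_mult_group) (simp_all add: fun_eq_iff nat_pow_def)
  have "x [^] n = \<one> \<longleftrightarrow> G.ord x dvd n" if "x \<in> carrier R - {\<zero>}" for x n
    using G.pow_eq_id[of x n] that by simp
  then show ?thesis by (auto simp: unity_roots_def)
qed

text \<open>By Lagrange \<open>D\<close> consists of roots of unity of exponent
  \<open>card D\<close>, and there are only that many. So the order determines the subgroup.\<close>

lemma mult_subgroup_eq_unity_roots:
  assumes D: "subgroup D (mult_of R)"
  shows "card D dvd card (carrier R) - 1" "D = unity_roots (card D)"
proof -
  interpret G: group "mult_of R" by (rule field_mult_group)
  have Dsub: "D \<subseteq> carrier R - {\<zero>}" using subgroup.subset[OF D] by simp
  show dvd: "card D dvd card (carrier R) - 1"
    using G.lagrange[OF D] finite_carrier dvd_triv_right[of "card D" "card (rcosets\<^bsub>mult_of R\<^esub> D)"]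
    by (simp add: order_def)
  have "x [^] card D = \<one>" if "x \<in> D" for x
    using group.pow_order_eq_1[OF G.subgroup_imp_group[OF D], of x] that
    by (simp add: order_def G.nat_pow_consistent[symmetric] nat_pow_mult_of)
  then have "D \<subseteq> unity_roots (card D)" using Dsub by (auto simp: unity_roots_def)
  moreover have "finite (unity_roots (card D))" using finite_carrier by (simp add: unity_roots_def)
  ultimately show "D = unity_roots (card D)"
    using card_unity_roots[OF dvd] by (metis card_subset_eq)
qed

lemma subfield_nonzero_eq_unity_roots:
  assumes K: "subfield K R"
  shows "card K - 1 dvd card (carrier R) - 1" "K - {\<zero>} = unity_roots (card K - 1)"
proof -
  have "\<zero> \<in> K" using subringE(2)[OF subfieldE(1)[OF K]] .
  moreover have "finite K" using subfieldE(3)[OF K] finite_carrier finite_subset by blast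
  ultimately have "card (K - {\<zero>}) = card K - 1" by simp
  then show "card K - 1 dvd card (carrier R) - 1" "K - {\<zero>} = unity_roots (card K - 1)"
    using mult_subgroup_eq_unity_roots[OF subgroup_mult_of[OF K]] by simp_all
qed

lemma card_subfield_gt_one:
  assumes K: "subfield K R"
  shows "card K > 1"
proof -
  have "finite K" using subfieldE(3)[OF K] finite_carrier finite_subset by blast
  moreover have "{\<zero>, \<one>} \<subseteq> K" using subringE(2,3)[OF subfieldE(1)[OF K]] by simp
  ultimately show ?thesis using card_mono[of K "{\<zero>, \<one>}"] by simp
qed

lemma subfield_eq_if_card_eq:
  assumes K: "subfield K R" and L: "subfield L R" and "card K = card L"
  shows "K = L"
proof -
  have "K - {\<zero>} = L - {\<zero>}"
    using subfield_nonzero_eq_unity_roots(2)[OF K] subfield_nonzero_eq_unity_roots(2)[OF L] assms(3)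
    by simp
  then show ?thesis
    using subringE(2)[OF subfieldE(1)[OF K]] subringE(2)[OF subfieldE(1)[OF L]] by blast
qed

text \<open>Lagrange in the additive group makes \<open>card K\<close> a power p^d; Lagrange in the
  unit group makes p^d - 1 divide p^n - 1, hence \<open>d\<close> divides \<open>n\<close>.\<close>

lemma card_subfield:
  assumes K: "subfield K R" and p: "Factorial_Ring.prime p" and q: "card (carrier R) = p ^ n"
  obtains d where "d dvd n" "card K = p ^ d"
proof -
  have "additive_subgroup K R"
    using subring.axioms(1)[OF subfieldE(1)[OF K]] by (simp add: additive_subgroup_def)
  then have "card K dvd p ^ n"
    using a_lagrange[OF finite_carrier, of K] q by (metis dvd_triv_right order_def)
  then obtain d where d: "card K = p ^ d" using divides_primepow_nat[OF p] by blast
  then have "d \<noteq> 0" using card_subfield_gt_one[OF K] by (cases d) auto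
  moreover have "p ^ d - 1 dvd p ^ n - 1"
    using subfield_nonzero_eq_unity_roots(1)[OF K] d q by simp
  ultimately have "d dvd n" using power_minus_one_dvd_iff[of p d n] prime_ge_2_nat[OF p] by simp
  then show thesis using d that by blast
qed

lemma prime_multiple_one_eq_zero:
  assumes q: "card (carrier R) = p ^ n"
  shows "[p] \<cdot> \<one> = \<zero>"
proof (rule ccontr)
  assume nz: "[p] \<cdot> \<one> \<noteq> \<zero>"
  \<comment> \<open>Without zero divisors the assumption passes to all powers of \<open>p\<close>,
    among them the order of the additive group, which annihilates everything.\<close>
  have "[(p ^ k)] \<cdot> \<one> \<noteq> \<zero>" for k :: nat
  proof (induction k)
    case (Suc k)
    have "[(p ^ Suc k)] \<cdot> \<one> = [p] \<cdot> ([(p ^ k)] \<cdot> \<one>)"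
      by (simp add: add.nat_pow_pow mult.commute)
    also have "\<dots> = [p] \<cdot> \<one> \<otimes> [(p ^ k)] \<cdot> \<one>"
      by (simp add: add_pow_ldistr)
    finally show ?case using Suc nz by (simp add: integral_iff)
  qed simp
  moreover have "[(card (carrier R))] \<cdot> \<one> = \<zero>"
    using add.pow_order_eq_1[of \<one>] by (simp add: order_def)
  ultimately show False using q by metis
qed

text \<open>The witness is the fixed set of the power map with exponent p^d, which is additive by
  Frobenius. It consists of zero and the roots of unity of exponent p^d - 1, and this exponent
  divides p^n - 1 because \<open>d\<close> divides \<open>n\<close>.\<close>

lemma subfield_exists:
  assumes p: "Factorial_Ring.prime p" and q: "card (carrier R) = p ^ n" and n: "n \<ge> 1" and d: "d dvd n"
  obtains K where "subfield K R" "card K = p ^ d"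
proof -
  let ?Q = "p ^ d"
  let ?K = "{x \<in> carrier R. x [^] ?Q = x}"
  note frob = frobenius_add[OF p prime_multiple_one_eq_zero[OF q]]
  have d1: "d \<ge> 1" using n d by (cases d) auto
  have Q: "?Q \<noteq> 0" "?Q > 1" using d1 prime_gt_1_nat[OF p] one_less_power[of p d] by simp_all
  have "subfield ?K R"
  proof (rule subfieldI'[OF subringI])
    fix x y assume xy: "x \<in> ?K" "y \<in> ?K"
    then show "x \<otimes> y \<in> ?K" by (simp add: nat_pow_distrib)
    show "x \<oplus> y \<in> ?K" using xy by (simp add: frob)
  next
    fix x assume x: "x \<in> ?K"
    \<comment> \<open>Applying Frobenius to \<open>x \<oplus> \<ominus> x\<close> treats negation
      uniformly in odd \<open>p\<close> and p = 2.\<close>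
    have "\<zero> = (x \<oplus> \<ominus> x) [^] ?Q" using x Q by (simp add: r_neg nat_pow_zero)
    also have "\<dots> = x \<oplus> (\<ominus> x) [^] ?Q" using x frob[of x "\<ominus> x" d] by simp
    finally have "(\<ominus> x) [^] ?Q = \<ominus> x"
      using x by (metis (no_types, lifting) a_inv_closed add.inv_equality mem_Collect_eq minus_minus nat_pow_closed)
    then show "\<ominus> x \<in> ?K" using x by simp
  next
    fix x assume x: "x \<in> ?K - {\<zero>}"
    have "inv x [^] ?Q = inv x [^] ?Q \<otimes> (x \<otimes> inv x)" using x inv_nonzero[of x] by simp
    also have "\<dots> = (inv x [^] ?Q \<otimes> x [^] ?Q) \<otimes> inv x" using x inv_nonzero[of x] by (simp add: m_assoc)
    also have "\<dots> = inv x"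
      using x inv_nonzero[of x] nat_pow_distrib[of "inv x" x ?Q, symmetric] by simp
    finally show "inv x \<in> ?K" using x inv_nonzero[of x] by simp
  qed auto
  moreover have "card ?K = ?Q"
  proof -
    have "x [^] (?Q - 1) = \<one> \<longleftrightarrow> x [^] ?Q = x" if x: "x \<in> carrier R" "x \<noteq> \<zero>" for x
    proof -
      have "x [^] ?Q = x [^] Suc (?Q - 1)" using Q by simp
      then have "x [^] ?Q = x [^] (?Q - 1) \<otimes> x" by simp
      then show ?thesis using m_rcancel[of x "x [^] (?Q - 1)" \<one>] x by simp
    qed
    then have "?K = insert \<zero> (unity_roots (?Q - 1))"
      using Q by (auto simp: unity_roots_def nat_pow_zero)
    moreover have "\<zero> \<notin> unity_roots (?Q - 1)" "finite (unity_roots (?Q - 1))"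
      using finite_carrier by (auto simp: unity_roots_def)
    moreover have "?Q - 1 dvd card (carrier R) - 1"
      unfolding q using power_minus_one_dvd_iff[of p d n] d d1 prime_ge_2_nat[OF p] by simp
    ultimately show ?thesis using Q by (simp add: card_unity_roots)
  qed
  ultimately show thesis by (rule that)
qed

end

section \<open>Subspaces, hyperplanes and stabilizers\<close>

context ring
begin

text \<open>\<open>K\<close> is an arbitrary set of scalars because the notion is applied to
  subfields, to multiplicative subgroups and to the empty set.\<close>

definition lin_subspace :: "'a set \<Rightarrow> 'a set \<Rightarrow> bool" where
  "lin_subspace K V \<longleftrightarrow> additive_subgroup V R \<and> (\<forall>k\<in>K. \<forall>v\<in>V. k \<otimes> v \<in> V)"

text \<open>For a subfield \<open>K\<close> these are the hyperplanes; maximality replaces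
  codimension one, so no dimension theory enters.\<close>

definition maximal_subspace :: "'a set \<Rightarrow> 'a set \<Rightarrow> bool" where
  "maximal_subspace K V \<longleftrightarrow> lin_subspace K V \<and> V \<noteq> carrier R \<and>
     (\<forall>W. lin_subspace K W \<longrightarrow> V \<subseteq> W \<longrightarrow> W = V \<or> W = carrier R)"

definition stabilizer :: "'a set \<Rightarrow> 'a set" where
  "stabilizer V = {a \<in> carrier R. \<forall>v\<in>V. a \<otimes> v \<in> V}"

text \<open>The span of \<open>V\<close> and \<open>x\<close> when \<open>V\<close> is a subspace
  over a subfield \<open>K\<close>.\<close>

definition adjoin :: "'a set \<Rightarrow> 'a set \<Rightarrow> 'a \<Rightarrow> 'a set" where
  "adjoin K V x = {v \<oplus> k \<otimes> x | v k. v \<in> V \<and> k \<in> K}"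

lemma additive_subgroupI':
  assumes "V \<subseteq> carrier R" "\<zero> \<in> V" "\<And>x y. x \<in> V \<Longrightarrow> y \<in> V \<Longrightarrow> x \<oplus> y \<in> V"
    "\<And>x. x \<in> V \<Longrightarrow> \<ominus> x \<in> V"
  shows "additive_subgroup V R"
  using assms by (intro additive_subgroup.intro add.subgroupI) auto

lemma lin_subspaceD:
  assumes "lin_subspace K V"
  shows "V \<subseteq> carrier R" "\<zero> \<in> V" "x \<in> V \<Longrightarrow> y \<in> V \<Longrightarrow> x \<oplus> y \<in> V"
    "x \<in> V \<Longrightarrow> \<ominus> x \<in> V" "k \<in> K \<Longrightarrow> x \<in> V \<Longrightarrow> k \<otimes> x \<in> V"
proof -
  interpret additive_subgroup V R using assms by (simp add: lin_subspace_def)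
  show "V \<subseteq> carrier R" by (rule a_subset)
  show "\<zero> \<in> V" by simp
  show "x \<in> V \<Longrightarrow> y \<in> V \<Longrightarrow> x \<oplus> y \<in> V" by simp
  show "x \<in> V \<Longrightarrow> \<ominus> x \<in> V" using ring_axioms by (intro a_inv_closed) (simp add: abelian_group_axioms)
  show "k \<in> K \<Longrightarrow> x \<in> V \<Longrightarrow> k \<otimes> x \<in> V" using assms by (simp add: lin_subspace_def)
qed

lemma lin_subspaceI:
  assumes "V \<subseteq> carrier R" "\<zero> \<in> V" "\<And>x y. x \<in> V \<Longrightarrow> y \<in> V \<Longrightarrow> x \<oplus> y \<in> V"
    "\<And>x. x \<in> V \<Longrightarrow> \<ominus> x \<in> V" "\<And>k x. k \<in> K \<Longrightarrow> x \<in> V \<Longrightarrow> k \<otimes> x \<in> V"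
  shows "lin_subspace K V"
  unfolding lin_subspace_def using additive_subgroupI'[OF assms(1-4)] assms(5) by blast

lemma lin_subspace_Int:
  assumes "lin_subspace K V" "lin_subspace K W"
  shows "lin_subspace K (V \<inter> W)"
  by (rule lin_subspaceI) (use lin_subspaceD[OF assms(1)] lin_subspaceD[OF assms(2)] in auto)

end

context finite_field
begin

context
  fixes K assumes K: "subfield K R"
begin

lemmas subfield_simps = subringE[OF subfieldE(1)[OF K]]

lemma lin_subspace_zero: "lin_subspace K {\<zero>}"
  by (rule lin_subspaceI) (use subfield_simps(1) in auto)

lemma lin_subspace_adjoin:
  assumes V: "lin_subspace K V" and x: "x \<in> carrier R"
  shows "lin_subspace K (adjoin K V x)"
proof (rule lin_subspaceI)
  note VD = lin_subspaceD[OF V]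
  have VR: "v \<in> carrier R" if "v \<in> V" for v using VD(1) that by blast
  have KR: "k \<in> carrier R" if "k \<in> K" for k using subfield_simps(1) that by blast
  show "adjoin K V x \<subseteq> carrier R" unfolding adjoin_def using VR KR x by auto
  have "\<zero> = \<zero> \<oplus> \<zero> \<otimes> x" using x by simp
  then show "\<zero> \<in> adjoin K V x" unfolding adjoin_def using VD(2) subfield_simps(2) by blast
  fix y assume "y \<in> adjoin K V x"
  then obtain v k where y: "y = v \<oplus> k \<otimes> x" "v \<in> V" "k \<in> K" unfolding adjoin_def by blast
  note yR = VR[OF y(2)] KR[OF y(3)]
  have "\<ominus> y = \<ominus> v \<oplus> (\<ominus> k) \<otimes> x" using yR x unfolding y(1) by algebra
  then show "\<ominus> y \<in> adjoin K V x"
    unfolding adjoin_def using VD(4)[OF y(2)] subfield_simps(5)[OF y(3)] by blast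
  show "c \<otimes> y \<in> adjoin K V x" if c: "c \<in> K" for c
  proof -
    have "c \<otimes> y = c \<otimes> v \<oplus> (c \<otimes> k) \<otimes> x" using yR x KR[OF c] unfolding y(1) by algebra
    then show ?thesis
      unfolding adjoin_def using VD(5)[OF c y(2)] subfield_simps(6)[OF c y(3)] by blast
  qed
  fix z assume "z \<in> adjoin K V x"
  then obtain w l where z: "z = w \<oplus> l \<otimes> x" "w \<in> V" "l \<in> K" unfolding adjoin_def by blast
  note zR = VR[OF z(2)] KR[OF z(3)]
  have "y \<oplus> z = (v \<oplus> w) \<oplus> (k \<oplus> l) \<otimes> x" using yR zR x unfolding y(1) z(1) by algebra
  then show "y \<oplus> z \<in> adjoin K V x"
    unfolding adjoin_def using VD(3)[OF y(2) z(2)] subfield_simps(7)[OF y(3) z(3)] by blast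
qed

lemma subset_adjoin:
  assumes V: "lin_subspace K V" and x: "x \<in> carrier R"
  shows "V \<subseteq> adjoin K V x" "x \<in> adjoin K V x"
proof -
  note VD = lin_subspaceD[OF V]
  have "v = v \<oplus> \<zero> \<otimes> x" if "v \<in> V" for v using VD(1) that x by auto
  then show "V \<subseteq> adjoin K V x" unfolding adjoin_def using subfield_simps(2) by blast
  have "x = \<zero> \<oplus> \<one> \<otimes> x" using x by simp
  then show "x \<in> adjoin K V x" unfolding adjoin_def using VD(2) subfield_simps(3) by blast
qed

lemma mult_mem_lin_subspaceD:
  assumes V: "lin_subspace K V" and x: "x \<in> carrier R" "x \<notin> V" and k: "k \<in> K" "k \<otimes> x \<in> V"
  shows "k = \<zero>"
proof (rule ccontr)
  assume nz: "k \<noteq> \<zero>"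
  have kR: "k \<in> carrier R" using k(1) subfield_simps(1) by blast
  have inv: "inv k \<in> K" using subfield_m_inv(1)[OF K, of k] k nz by simp
  then have "inv k \<otimes> (k \<otimes> x) \<in> V" using lin_subspaceD(5)[OF V] k by blast
  moreover have "inv k \<otimes> (k \<otimes> x) = x"
    using inv_nonzero[OF kR nz] kR x m_assoc[of "inv k" k x] by simp
  ultimately show False using x by simp
qed

text \<open>The sum of \<open>V\<close> and K x is direct: two representations of one element would
  put \<open>(k \<ominus> l) \<otimes> x\<close> into \<open>V\<close>, hence
  \<open>k = l\<close>.\<close>

lemma card_adjoin:
  assumes V: "lin_subspace K V" and x: "x \<in> carrier R" "x \<notin> V"
  shows "card (adjoin K V x) = card V * card K"
proof -
  note VD = lin_subspaceD[OF V]
  have VR: "v \<in> carrier R" if "v \<in> V" for v using VD(1) that by blast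
  have KR: "k \<in> carrier R" if "k \<in> K" for k using subfield_simps(1) that by blast
  have "adjoin K V x = (\<lambda>(v, k). v \<oplus> k \<otimes> x) ` (V \<times> K)"
    unfolding adjoin_def by auto
  moreover have "inj_on (\<lambda>(v, k). v \<oplus> k \<otimes> x) (V \<times> K)"
  proof (rule inj_onI, clarify)
    fix v k w l assume *: "v \<in> V" "k \<in> K" "w \<in> V" "l \<in> K" "v \<oplus> k \<otimes> x = w \<oplus> l \<otimes> x"
    note R = VR[OF *(1)] VR[OF *(3)] KR[OF *(2)] KR[OF *(4)] x(1)
    have "(k \<ominus> l) \<otimes> x = (v \<oplus> k \<otimes> x) \<ominus> v \<ominus> l \<otimes> x" using R by algebra
    also have "\<dots> = w \<ominus> v" unfolding *(5) using R by algebra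
    also have "\<dots> \<in> V" unfolding a_minus_def using VD *(1,3) by blast
    finally have "(k \<ominus> l) \<otimes> x \<in> V" .
    moreover have "k \<ominus> l \<in> K" unfolding a_minus_def using subfield_simps(5,7) *(2,4) by blast
    ultimately have "k \<ominus> l = \<zero>" using mult_mem_lin_subspaceD[OF V x] by blast
    then have "k = l" using R by simp
    moreover from this have "v = w" using *(5) R by simp
    ultimately show "v = w \<and> k = l" by simp
  qed
  ultimately show ?thesis by (simp add: card_image card_cartesian_product)
qed

lemma card_maximal_subspace:
  assumes V: "maximal_subspace K V"
  shows "card V * card K = card (carrier R)"
proof -
  have V': "lin_subspace K V" "V \<noteq> carrier R" using V by (auto simp: maximal_subspace_def)
  then obtain x where x: "x \<in> carrier R" "x \<notin> V" using lin_subspaceD(1)[OF V'(1)] by blast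
  have "adjoin K V x = carrier R"
    using V lin_subspace_adjoin[OF V'(1) x(1)] subset_adjoin[OF V'(1) x(1)] x(2)
    unfolding maximal_subspace_def by blast
  then show ?thesis using card_adjoin[OF V'(1) x] by simp
qed

text \<open>The family of proper subspaces is finite, and nonempty because \<open>{\<zero>}\<close>
  belongs to it; when \<open>K\<close> is the whole field, \<open>{\<zero>}\<close> is the
  hyperplane.\<close>

lemma maximal_subspace_exists:
  obtains V where "maximal_subspace K V"
proof -
  let ?A = "{W. lin_subspace K W \<and> W \<noteq> carrier R}"
  have "?A \<subseteq> Pow (carrier R)" using lin_subspaceD(1) by blast
  then have fin: "finite ?A" using finite_carrier by (metis finite_Pow_iff finite_subset)
  have "{\<zero>} \<noteq> carrier R" using one_closed zero_not_one by (metis singletonD)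
  then have "{\<zero>} \<in> ?A" using lin_subspace_zero by blast
  then obtain V where V: "V \<in> ?A" "\<forall>W\<in>?A. V \<subseteq> W \<longrightarrow> V = W"
    using finite_has_maximal[OF fin] by blast
  then have "maximal_subspace K V" unfolding maximal_subspace_def by blast
  then show thesis by (rule that)
qed

text \<open>If \<open>W\<close> lies strictly between \<open>V\<close> and the field and
  \<open>x\<close> is outside \<open>W\<close>, then \<open>adjoin K V x\<close> and
  \<open>W\<close> are both larger than \<open>V\<close> but meet in \<open>V\<close>.\<close>

lemma maximal_subspace_if_meet_irreducible:
  assumes V: "lin_subspace K V" "V \<noteq> carrier R"
    and irr: "\<And>U W. lin_subspace K U \<Longrightarrow> lin_subspace K W \<Longrightarrow> U \<inter> W = V \<Longrightarrow> U = V \<or> W = V"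
  shows "maximal_subspace K V"
  unfolding maximal_subspace_def
proof (intro conjI allI impI V, rule ccontr)
  fix W assume W: "lin_subspace K W" "V \<subseteq> W" "\<not> (W = V \<or> W = carrier R)"
  then obtain x where x: "x \<in> carrier R" "x \<notin> W" using lin_subspaceD(1)[OF W(1)] by blast
  have "adjoin K V x \<inter> W = V"
  proof
    show "V \<subseteq> adjoin K V x \<inter> W" using subset_adjoin[OF V(1) x(1)] W by blast
    show "adjoin K V x \<inter> W \<subseteq> V"
    proof
      fix y assume y: "y \<in> adjoin K V x \<inter> W"
      then obtain v k where vk: "y = v \<oplus> k \<otimes> x" "v \<in> V" "k \<in> K" unfolding adjoin_def by blast
      have R: "v \<in> carrier R" "k \<in> carrier R"
        using vk subfield_simps(1) lin_subspaceD(1)[OF V(1)] by blast+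
      have "k \<otimes> x = \<ominus> v \<oplus> y" using R x(1) unfolding vk(1) by algebra
      also have "\<dots> \<in> W"
        using lin_subspaceD(3,4)[OF W(1)] vk(2) W(2) y by blast
      finally have "k = \<zero>" using mult_mem_lin_subspaceD[OF W(1) x vk(3)] by simp
      then show "y \<in> V" using vk R x by simp
    qed
  qed
  then have "adjoin K V x = V \<or> W = V"
    using irr[OF lin_subspace_adjoin[OF V(1) x(1)] W(1)] by blast
  then show False using W x subset_adjoin(2)[OF V(1) x(1)] by blast
qed

end

lemma subfield_stabilizer:
  assumes V: "additive_subgroup V R"
  shows "subfield (stabilizer V) R"
proof -
  interpret additive_subgroup V R by fact
  \<comment> \<open>With no scalars, \<open>lin_subspaceD\<close> delivers the closure properties of
    an additive subgroup.\<close>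
  have V': "lin_subspace {} V" using V by (simp add: lin_subspace_def)
  note VD = lin_subspaceD[OF V']
  have VR: "v \<in> carrier R" if "v \<in> V" for v using VD(1) that by blast
  show ?thesis
  proof (rule subfieldI'[OF subringI])
    show "stabilizer V \<subseteq> carrier R" "\<one> \<in> stabilizer V"
      using VR by (auto simp: stabilizer_def)
  next
    fix a assume a: "a \<in> stabilizer V"
    then show "\<ominus> a \<in> stabilizer V" using VR VD by (auto simp: stabilizer_def l_minus)
    fix b assume b: "b \<in> stabilizer V"
    show "a \<otimes> b \<in> stabilizer V" using a b VR by (auto simp: stabilizer_def m_assoc)
    show "a \<oplus> b \<in> stabilizer V" using a b VR VD by (auto simp: stabilizer_def l_distr)
  next
    fix a assume "a \<in> stabilizer V - {\<zero>}"
    then have a: "a \<in> carrier R" "a \<noteq> \<zero>" "(\<lambda>v. a \<otimes> v) ` V \<subseteq> V" by (auto simp: stabilizer_def)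
    \<comment> \<open>Inverses come from finiteness: multiplication by \<open>a\<close> is an
      injection of the finite set \<open>V\<close> into itself, hence onto.\<close>
    have "inj_on (\<lambda>v. a \<otimes> v) V" using VR a m_lcancel by (auto intro!: inj_onI)
    moreover have "finite V" using VD(1) finite_carrier finite_subset by blast
    ultimately have surj: "(\<lambda>v. a \<otimes> v) ` V = V" using a(3) endo_inj_surj by blast
    have "inv a \<otimes> v \<in> V" if v: "v \<in> V" for v
    proof -
      obtain u where u: "u \<in> V" "v = a \<otimes> u" using surj v by blast
      then have "inv a \<otimes> v = u" using inv_nonzero[OF a(1,2)] a VR[of u] by (simp add: m_assoc[symmetric])
      then show ?thesis using u by simp
    qed
    then show "inv a \<in> stabilizer V" using inv_nonzero[OF a(1,2)] by (simp add: stabilizer_def)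
  qed
qed

lemma lin_subspace_stabilizer:
  "additive_subgroup V R \<Longrightarrow> lin_subspace (stabilizer V) V"
  by (simp add: lin_subspace_def stabilizer_def)

text \<open>\<open>V\<close> is also a proper subspace over its stabilizer L. Adjoining one vector
  over L shows that |V| |L| is at most the order of the field, which is |V| |K|; since K is
  contained in L, they are equal.\<close>

lemma stabilizer_maximal_subspace:
  assumes K: "subfield K R" and V: "maximal_subspace K V"
  shows "stabilizer V = K"
proof -
  have V': "lin_subspace K V" "V \<noteq> carrier R" using V by (auto simp: maximal_subspace_def)
  then have add: "additive_subgroup V R" by (simp add: lin_subspace_def)
  note L = subfield_stabilizer[OF add]
  note LV = lin_subspace_stabilizer[OF add]
  obtain x where x: "x \<in> carrier R" "x \<notin> V" using lin_subspaceD(1)[OF V'(1)] V'(2) by blast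
  have "card V * card (stabilizer V) \<le> card (carrier R)"
    using card_adjoin[OF L LV x] lin_subspaceD(1)[OF lin_subspace_adjoin[OF L LV x(1)]]
      card_mono[OF finite_carrier] by metis
  then have "card V * card (stabilizer V) \<le> card V * card K"
    using card_maximal_subspace[OF K V] by simp
  moreover have fV: "finite V" using lin_subspaceD(1)[OF V'(1)] finite_carrier finite_subset by blast
  moreover have "card V > 0" using fV lin_subspaceD(2)[OF V'(1)] by (auto simp: card_gt_0_iff)
  ultimately have "card (stabilizer V) \<le> card K" by simp
  moreover have "K \<subseteq> stabilizer V"
    using lin_subspaceD(5)[OF V'(1)] subfieldE(3)[OF K] by (auto simp: stabilizer_def)
  moreover have "finite (stabilizer V)" using finite_carrier by (simp add: stabilizer_def)
  ultimately show ?thesis using card_seteq by metis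
qed

lemma maximal_subspace_scale:
  assumes K: "subfield K R" and V: "maximal_subspace K V" and a: "a \<in> carrier R" "a \<noteq> \<zero>"
  shows "lin_subspace K ((\<lambda>v. a \<otimes> v) ` V)" "card ((\<lambda>v. a \<otimes> v) ` V) = card V"
proof -
  have V': "lin_subspace K V" using V by (auto simp: maximal_subspace_def)
  note VD = lin_subspaceD[OF V']
  have VR: "v \<in> carrier R" if "v \<in> V" for v using VD(1) that by blast
  have KR: "k \<in> carrier R" if "k \<in> K" for k using subfieldE(3)[OF K] that by blast
  show "lin_subspace K ((\<lambda>v. a \<otimes> v) ` V)"
  proof (rule lin_subspaceI)
    show "(\<lambda>v. a \<otimes> v) ` V \<subseteq> carrier R" using VR a by auto
    show "\<zero> \<in> (\<lambda>v. a \<otimes> v) ` V" using VD(2) a by (auto simp: image_iff intro!: bexI[of _ \<zero>])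
    fix y assume "y \<in> (\<lambda>v. a \<otimes> v) ` V"
    then obtain v where v: "v \<in> V" "y = a \<otimes> v" by blast
    have "\<ominus> y = a \<otimes> (\<ominus> v)" using v VR a by (simp add: r_minus)
    then show "\<ominus> y \<in> (\<lambda>v. a \<otimes> v) ` V" using VD(4)[OF v(1)] by blast
    show "k \<otimes> y \<in> (\<lambda>v. a \<otimes> v) ` V" if k: "k \<in> K" for k
    proof -
      have "k \<otimes> y = a \<otimes> (k \<otimes> v)" using v VR a KR[OF k] by (simp add: m_lcomm)
      then show ?thesis using VD(5)[OF k v(1)] by blast
    qed
    fix z assume "z \<in> (\<lambda>v. a \<otimes> v) ` V"
    then obtain w where w: "w \<in> V" "z = a \<otimes> w" by blast
    have "y \<oplus> z = a \<otimes> (v \<oplus> w)" using v w VR a by (simp add: r_distr)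
    then show "y \<oplus> z \<in> (\<lambda>v. a \<otimes> v) ` V" using VD(3)[OF v(1) w(1)] by blast
  qed
  show "card ((\<lambda>v. a \<otimes> v) ` V) = card V"
    by (rule card_image) (use VR a m_lcancel in \<open>auto intro!: inj_onI\<close>)
qed

text \<open>Double counting: if no multiple of \<open>W\<close> equals \<open>V\<close>, then all intersections \<open>V \<inter> a W\<close>
  have index at least \<open>card K\<close> in \<open>V\<close>, and they are too small for the number of pairs
  \<open>(a, x)\<close> with \<open>x \<in> V \<inter> a W\<close> nonzero.\<close>

lemma maximal_subspaces_scale:
  assumes K: "subfield K R" and V: "maximal_subspace K V" and W: "maximal_subspace K W"
  obtains a where "a \<in> carrier R" "a \<noteq> \<zero>" "V = (\<lambda>w. a \<otimes> w) ` W"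
proof -
  let ?Q = "card K" and ?s = "card V" and ?U = "carrier R - {\<zero>}"
  let ?aW = "\<lambda>a. (\<lambda>w. a \<otimes> w) ` W"
  have V': "lin_subspace K V" "V \<noteq> carrier R" and W': "lin_subspace K W" "W \<noteq> carrier R"
    using V W by (auto simp: maximal_subspace_def)
  note VD = lin_subspaceD[OF V'(1)] and WD = lin_subspaceD[OF W'(1)]
  have fin: "finite V" "finite W" using VD(1) WD(1) finite_carrier finite_subset by blast+
  have Q: "?Q \<ge> 2" using card_subfield_gt_one[OF K] by simp
  have q: "card (carrier R) = ?s * ?Q" using card_maximal_subspace[OF K V] by simp
  have "card W * ?Q = ?s * ?Q" using card_maximal_subspace[OF K W] q by simp
  then have cW: "card W = ?s" using Q by simp
  have s: "?s \<ge> 1" using fin VD(2) by (auto simp: Suc_le_eq card_gt_0_iff)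
  have "\<exists>a\<in>?U. V = ?aW a"
  proof (rule ccontr)
    assume no: "\<not> ?thesis"
    \<comment> \<open>This is \<open>card (V \<inter> ?aW a) * ?Q \<le> ?s\<close>, with the
      contribution of zero split off as the summand \<open>?Q\<close>.\<close>
    have small: "card (V \<inter> ?aW a - {\<zero>}) * ?Q + ?Q \<le> ?s" if a: "a \<in> ?U" for a
    proof -
      have aW: "lin_subspace K (?aW a)" "card (?aW a) = ?s"
        using maximal_subspace_scale[OF K W] a cW by auto
      have U: "lin_subspace K (V \<inter> ?aW a)" by (rule lin_subspace_Int[OF V'(1) aW(1)])
      have "\<not> V \<subseteq> ?aW a"
      proof
        assume "V \<subseteq> ?aW a"
        then have "V = ?aW a"
          using aW(2) fin(2) by (intro card_subset_eq) auto
        then show False using no a by blast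
      qed
      then obtain x where x: "x \<in> V" "x \<notin> ?aW a" by blast
      then have x': "x \<in> carrier R" "x \<notin> V \<inter> ?aW a" using VD(1) by blast+
      have "adjoin K (V \<inter> ?aW a) x \<subseteq> V"
        unfolding adjoin_def using x VD(3,5) by blast
      then have "card (V \<inter> ?aW a) * ?Q \<le> ?s"
        using card_adjoin[OF K U x'] card_mono[OF fin(1)] by metis
      moreover have "card (V \<inter> ?aW a) = Suc (card (V \<inter> ?aW a - {\<zero>}))"
        using fin(1) lin_subspaceD(2)[OF U] by (intro card.remove) auto
      ultimately show ?thesis by simp
    qed
    let ?P = "Sigma ?U (\<lambda>a. V \<inter> ?aW a - {\<zero>})"
    have "(?s - 1) * (?s - 1) \<le> card ?P"
    proof -
      \<comment> \<open>Nonzero \<open>x\<close> in \<open>V\<close> and \<open>w\<close> in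
        \<open>W\<close> give the multiplier a = x / w with \<open>x\<close> in a W, and
        \<open>w\<close> is recovered from \<open>x\<close> and a.\<close>
      let ?f = "\<lambda>(x, w). (x \<otimes> inv w, x)"
      have inj: "inj_on ?f ((V - {\<zero>}) \<times> (W - {\<zero>}))"
      proof (rule inj_onI)
        fix y z assume yz: "y \<in> (V - {\<zero>}) \<times> (W - {\<zero>})" "z \<in> (V - {\<zero>}) \<times> (W - {\<zero>})" "?f y = ?f z"
        then obtain x w w' where yz': "y = (x, w)" "z = (x, w')" by fastforce
        have *: "x \<in> V" "x \<noteq> \<zero>" "w \<in> W" "w \<noteq> \<zero>" "w' \<in> W" "w' \<noteq> \<zero>"
          "x \<otimes> inv w = x \<otimes> inv w'" using yz yz' by auto
        have R: "x \<in> carrier R" "w \<in> carrier R" "w' \<in> carrier R" using * VD(1) WD(1) by blast+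
        have eq: "inv w = inv w'"
          using *(7) m_lcancel[of x "inv w" "inv w'"] *(2) R inv_nonzero(1) *(4,6) by simp
        have "w = w \<otimes> (inv w' \<otimes> w')" using R inv_nonzero[OF R(3) *(6)] by simp
        also have "\<dots> = (w \<otimes> inv w) \<otimes> w'" using R inv_nonzero[OF R(3) *(6)] eq by (simp add: m_assoc)
        finally show "y = z" using R inv_nonzero[OF R(2) *(4)] yz' by simp
      qed
      have "?f ` ((V - {\<zero>}) \<times> (W - {\<zero>})) \<subseteq> ?P"
      proof
        fix y assume "y \<in> ?f ` ((V - {\<zero>}) \<times> (W - {\<zero>}))"
        then obtain x w where *: "x \<in> V" "x \<noteq> \<zero>" "w \<in> W" "w \<noteq> \<zero>" and y: "y = (x \<otimes> inv w, x)"
          by auto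
        have R: "x \<in> carrier R" "w \<in> carrier R" using * VD(1) WD(1) by blast+
        note i = inv_nonzero[OF R(2) *(4)]
        have "x = (x \<otimes> inv w) \<otimes> w" using R i by (simp add: m_assoc)
        then have "x \<in> ?aW (x \<otimes> inv w)" using *(3) by blast
        moreover have "x \<otimes> inv w \<in> ?U" using R i * by (simp add: integral_iff)
        ultimately show "y \<in> ?P" using * y by blast
      qed
      moreover have "finite ?P" using finite_carrier fin by (intro finite_SigmaI) auto
      ultimately have "card ((V - {\<zero>}) \<times> (W - {\<zero>})) \<le> card ?P"
        using card_inj_on_le[OF inj] by blast
      then show ?thesis using fin VD(2) WD(2) cW by (simp add: card_cartesian_product)
    qed
    also have "card ?P = (\<Sum>a\<in>?U. card (V \<inter> ?aW a - {\<zero>}))"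
      using finite_carrier fin by (intro card_SigmaI) auto
    finally have "(?s - 1) * (?s - 1) * ?Q \<le> (\<Sum>a\<in>?U. card (V \<inter> ?aW a - {\<zero>}) * ?Q)"
      by (simp add: sum_distrib_right[symmetric])
    then have "(?s - 1) * (?s - 1) * ?Q + (\<Sum>a\<in>?U. ?Q) \<le> (\<Sum>a\<in>?U. card (V \<inter> ?aW a - {\<zero>}) * ?Q + ?Q)"
      by (simp add: sum.distrib)
    also have "\<dots> \<le> (\<Sum>a\<in>?U. ?s)" by (intro sum_mono small)
    finally have "(?s - 1) * (?s - 1) * ?Q + (?s * ?Q - 1) * ?Q \<le> (?s * ?Q - 1) * ?s"
      using finite_carrier q by simp
    \<comment> \<open>Integers remove the truncated subtraction. With s = \<open>?s\<close> and Q =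
      \<open>?Q\<close> the inequality then simplifies to s (Q - 1)^2 \<le> 0, impossible since Q is
      at least 2.\<close>
    then have "int ((?s - 1) * (?s - 1) * ?Q + (?s * ?Q - 1) * ?Q) \<le> int ((?s * ?Q - 1) * ?s)"
      by (simp only: of_nat_le_iff)
    moreover have "?s * ?Q \<ge> 1" using s Q by simp
    ultimately have "(int ?s - 1) * (int ?s - 1) * int ?Q + (int ?s * int ?Q - 1) * int ?Q
        \<le> (int ?s * int ?Q - 1) * int ?s"
      using s by (simp add: of_nat_diff)
    then have "int ?s * ((int ?Q - 1) * (int ?Q - 1)) \<le> 0"
      by (simp add: algebra_simps)
    moreover have "int ?s * ((int ?Q - 1) * (int ?Q - 1)) > 0" using s Q by simp
    ultimately show False by linarith
  qed
  then show thesis using that by blast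
qed

end

section \<open>Subgroups of the affine group\<close>

context finite_field
begin

interpretation AGL: group "AGL1 R"
  by (rule group_AGL1)

text \<open>Restricted to the carrier, as the elements of \<open>AGL1\<close> are; equality of two
  such maps is tested at zero and one.\<close>

definition aff :: "'a \<Rightarrow> 'a \<Rightarrow> 'a \<Rightarrow> 'a" where
  "aff l m = (\<lambda>x\<in>carrier R. l \<otimes> x \<oplus> m)"

text \<open>For a subgroup, this is its image in the units, that is, its quotient by the
  translations in it.\<close>

definition linear_parts :: "('a \<Rightarrow> 'a) set \<Rightarrow> 'a set" where
  "linear_parts H = {l \<in> carrier R - {\<zero>}. \<exists>m\<in>carrier R. aff l m \<in> H}"

definition translation_parts :: "('a \<Rightarrow> 'a) set \<Rightarrow> 'a set" where
  "translation_parts H = {m \<in> carrier R. aff \<one> m \<in> H}"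

text \<open>A set of maps; it is a subgroup once \<open>D\<close> is a multiplicative group and
  \<open>V\<close> an additive group stable under \<open>D\<close>.\<close>

definition semidirect :: "'a set \<Rightarrow> 'a set \<Rightarrow> ('a \<Rightarrow> 'a) set" where
  "semidirect D V = {aff l m | l m. l \<in> D \<and> m \<in> V}"

lemma carrier_AGL: "carrier (AGL1 R) = semidirect (carrier R - {\<zero>}) (carrier R)"
  by (simp add: AGL1_def semidirect_def aff_def field_Units)

lemma aff_in_AGL:
  "l \<in> carrier R \<Longrightarrow> l \<noteq> \<zero> \<Longrightarrow> m \<in> carrier R \<Longrightarrow> aff l m \<in> carrier (AGL1 R)"
  unfolding carrier_AGL semidirect_def by blast

lemma AGL_cases:
  assumes "g \<in> carrier (AGL1 R)"
  obtains l m where "l \<in> carrier R" "l \<noteq> \<zero>" "m \<in> carrier R" "g = aff l m"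
  using assms unfolding carrier_AGL semidirect_def by blast

lemma aff_eq_iff:
  assumes "l \<in> carrier R" "m \<in> carrier R" "l' \<in> carrier R" "m' \<in> carrier R"
  shows "aff l m = aff l' m' \<longleftrightarrow> l = l' \<and> m = m'"
proof
  assume eq: "aff l m = aff l' m'"
  have "m = m'" using fun_cong[OF eq, of \<zero>] assms by (simp add: aff_def)
  moreover have "l \<oplus> m = l' \<oplus> m'" using fun_cong[OF eq, of \<one>] assms by (simp add: aff_def)
  ultimately show "l = l' \<and> m = m'" using assms by simp
qed simp

lemma aff_mult:
  assumes "l \<in> carrier R" "l \<noteq> \<zero>" "m \<in> carrier R" "l' \<in> carrier R" "l' \<noteq> \<zero>" "m' \<in> carrier R"
  shows "aff l m \<otimes>\<^bsub>AGL1 R\<^esub> aff l' m' = aff (l \<otimes> l') (l \<otimes> m' \<oplus> m)"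
proof -
  have "carrier (AGL1 R) \<subseteq> Bij (carrier R)"
    using subgroup.subset[OF subgroup_AGL1] by (simp add: BijGroup_def)
  then have "aff l m \<in> Bij (carrier R)" "aff l' m' \<in> Bij (carrier R)"
    using aff_in_AGL assms by blast+
  then have "aff l m \<otimes>\<^bsub>AGL1 R\<^esub> aff l' m' = compose (carrier R) (aff l m) (aff l' m')"
    by (simp add: AGL1_def BijGroup_def)
  also have "\<dots> = aff (l \<otimes> l') (l \<otimes> m' \<oplus> m)"
    using assms by (auto simp: aff_def compose_def fun_eq_iff restrict_def r_distr m_assoc a_assoc)
  finally show ?thesis .
qed

lemma AGL_one: "\<one>\<^bsub>AGL1 R\<^esub> = aff \<one> \<zero>"
proof -
  \<comment> \<open>An idempotent of a group is its identity.\<close>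
  have "aff \<one> \<zero> \<otimes>\<^bsub>AGL1 R\<^esub> aff \<one> \<zero> = aff \<one> \<zero>"
    by (simp add: aff_mult)
  then show ?thesis using AGL.l_cancel_one'[of "aff \<one> \<zero>" "aff \<one> \<zero>"] aff_in_AGL[of \<one> \<zero>] by simp
qed

lemma AGL_inv:
  assumes "l \<in> carrier R" "l \<noteq> \<zero>" "m \<in> carrier R"
  shows "inv\<^bsub>AGL1 R\<^esub> (aff l m) = aff (inv l) (\<ominus> (inv l \<otimes> m))"
proof (rule AGL.inv_equality)
  note i = inv_nonzero[OF assms(1,2)]
  show "aff (inv l) (\<ominus> (inv l \<otimes> m)) \<otimes>\<^bsub>AGL1 R\<^esub> aff l m = \<one>\<^bsub>AGL1 R\<^esub>"
    using assms i by (simp add: aff_mult AGL_one r_neg)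
  show "aff (inv l) (\<ominus> (inv l \<otimes> m)) \<in> carrier (AGL1 R)" "aff l m \<in> carrier (AGL1 R)"
    using assms i by (auto intro: aff_in_AGL)
qed

text \<open>The source of the conjugation computations below: the linear part \<open>l\<close> is
  unchanged, and the term \<open>b \<ominus> l \<otimes> b\<close> vanishes for translations, while
  for \<open>l \<noteq> \<one>\<close> it can be used to cancel \<open>m\<close>.\<close>

lemma aff_conjugate:
  assumes a: "a \<in> carrier R" "a \<noteq> \<zero>" and b: "b \<in> carrier R"
    and l: "l \<in> carrier R" "l \<noteq> \<zero>" and m: "m \<in> carrier R"
  shows "aff a b \<otimes>\<^bsub>AGL1 R\<^esub> aff l m \<otimes>\<^bsub>AGL1 R\<^esub> inv\<^bsub>AGL1 R\<^esub> (aff a b)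
    = aff l (a \<otimes> m \<oplus> (b \<ominus> l \<otimes> b))"
proof -
  note i = inv_nonzero[OF a]
  have nz: "a \<otimes> l \<noteq> \<zero>" using a l by (simp add: integral_iff)
  have "aff a b \<otimes>\<^bsub>AGL1 R\<^esub> aff l m \<otimes>\<^bsub>AGL1 R\<^esub> inv\<^bsub>AGL1 R\<^esub> (aff a b)
    = aff (a \<otimes> l \<otimes> inv a) ((a \<otimes> l) \<otimes> (\<ominus> (inv a \<otimes> b)) \<oplus> (a \<otimes> m \<oplus> b))"
    using a b l m i nz by (simp add: aff_mult AGL_inv)
  also have "a \<otimes> l \<otimes> inv a = (a \<otimes> inv a) \<otimes> l" using a l i(1) by (simp add: m_ac)
  also have "\<dots> = l" using l i(4) by simp
  also have "(a \<otimes> l) \<otimes> (\<ominus> (inv a \<otimes> b)) \<oplus> (a \<otimes> m \<oplus> b) = \<ominus> ((a \<otimes> inv a) \<otimes> (l \<otimes> b)) \<oplus> (a \<otimes> m \<oplus> b)"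
    using a l b m i(1) by algebra
  also have "\<dots> = a \<otimes> m \<oplus> (b \<ominus> l \<otimes> b)" unfolding i(4) using a l b m by algebra
  finally show ?thesis .
qed

lemma semidirect_mem_iff:
  assumes "D \<subseteq> carrier R" "V \<subseteq> carrier R" "l \<in> carrier R" "m \<in> carrier R"
  shows "aff l m \<in> semidirect D V \<longleftrightarrow> l \<in> D \<and> m \<in> V"
  unfolding semidirect_def using assms aff_eq_iff by blast

lemma linear_parts_semidirect:
  assumes "D \<subseteq> carrier R - {\<zero>}" "V \<subseteq> carrier R" "V \<noteq> {}"
  shows "linear_parts (semidirect D V) = D"
  using semidirect_mem_iff[of D V] assms unfolding linear_parts_def by blast

lemma translation_parts_semidirect:
  assumes "D \<subseteq> carrier R - {\<zero>}" "V \<subseteq> carrier R" "\<one> \<in> D"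
  shows "translation_parts (semidirect D V) = V"
  using semidirect_mem_iff[of D V \<one>] assms unfolding translation_parts_def by blast

lemma semidirect_Int:
  assumes "D \<subseteq> carrier R" "V \<subseteq> carrier R" "D' \<subseteq> carrier R" "V' \<subseteq> carrier R"
  shows "semidirect D V \<inter> semidirect D' V' = semidirect (D \<inter> D') (V \<inter> V')"
proof
  show "semidirect D V \<inter> semidirect D' V' \<subseteq> semidirect (D \<inter> D') (V \<inter> V')"
  proof
    fix g assume g: "g \<in> semidirect D V \<inter> semidirect D' V'"
    then obtain l m where lm: "g = aff l m" "l \<in> D" "m \<in> V" unfolding semidirect_def by blast
    then have "l \<in> D'" "m \<in> V'" using g semidirect_mem_iff[of D' V' l m] assms by auto
    then show "g \<in> semidirect (D \<inter> D') (V \<inter> V')" using lm unfolding semidirect_def by blast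
  qed
qed (auto simp: semidirect_def)

lemma mult_subgroupD:
  assumes "subgroup D (mult_of R)"
  shows "D \<subseteq> carrier R - {\<zero>}" "\<one> \<in> D" "a \<in> D \<Longrightarrow> b \<in> D \<Longrightarrow> a \<otimes> b \<in> D" "a \<in> D \<Longrightarrow> inv a \<in> D"
proof -
  interpret D: subgroup D "mult_of R" by fact
  show *: "D \<subseteq> carrier R - {\<zero>}" using D.subset by simp
  show "\<one> \<in> D" "a \<in> D \<Longrightarrow> b \<in> D \<Longrightarrow> a \<otimes> b \<in> D" using D.one_closed D.m_closed by auto
  show "inv a \<in> D" if a: "a \<in> D"
  proof -
    have "inv\<^bsub>mult_of R\<^esub> a = inv a" using * a by (intro m_inv_mult_of) auto
    then show ?thesis using subgroup.m_inv_closed[OF assms a] by simp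
  qed
qed

lemma subgroup_unity_roots: "subgroup (unity_roots e) (mult_of R)"
proof -
  interpret G: group "mult_of R" by (rule field_mult_group)
  show ?thesis
  proof (rule G.subgroupI)
    show "unity_roots e \<subseteq> carrier (mult_of R)" by (auto simp: unity_roots_def)
    show "unity_roots e \<noteq> {}" by (auto simp: unity_roots_def intro!: exI[of _ \<one>])
  next
    fix a b assume "a \<in> unity_roots e" "b \<in> unity_roots e"
    then show "a \<otimes>\<^bsub>mult_of R\<^esub> b \<in> unity_roots e"
      by (auto simp: unity_roots_def nat_pow_distrib integral_iff)
  next
    fix a assume a: "a \<in> unity_roots e"
    then have aG: "a \<in> carrier (mult_of R)" by (simp add: unity_roots_def)
    have "a [^] e = \<one>" using a by (simp add: unity_roots_def)
    then have "inv\<^bsub>mult_of R\<^esub> a [^]\<^bsub>mult_of R\<^esub> e = \<one>\<^bsub>mult_of R\<^esub>"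
      using G.nat_pow_inv[OF aG, of e] G.inv_one by (simp add: nat_pow_mult_of)
    then show "inv\<^bsub>mult_of R\<^esub> a \<in> unity_roots e"
      using G.inv_closed[OF aG] by (simp add: unity_roots_def nat_pow_mult_of)
  qed
qed

lemma subgroup_semidirect:
  assumes D: "subgroup D (mult_of R)" and V: "lin_subspace D V"
  shows "subgroup (semidirect D V) (AGL1 R)"
proof (rule AGL.subgroupI)
  note DD = mult_subgroupD[OF D] and VD = lin_subspaceD[OF V]
  show "semidirect D V \<subseteq> carrier (AGL1 R)"
    unfolding carrier_AGL semidirect_def using DD(1) VD(1) by blast
  show "semidirect D V \<noteq> {}" unfolding semidirect_def using DD(2) VD(2) by blast
  fix g assume "g \<in> semidirect D V"
  then obtain l m where g: "g = aff l m" "l \<in> D" "m \<in> V" unfolding semidirect_def by blast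
  then have lm: "l \<in> carrier R" "l \<noteq> \<zero>" "m \<in> carrier R" using DD(1) VD(1) by blast+
  have "inv l \<in> D" "\<ominus> (inv l \<otimes> m) \<in> V" using DD(4) VD(4,5) g by blast+
  then show "inv\<^bsub>AGL1 R\<^esub> g \<in> semidirect D V"
    unfolding g(1) AGL_inv[OF lm] semidirect_def by blast
  fix h assume "h \<in> semidirect D V"
  then obtain l' m' where h: "h = aff l' m'" "l' \<in> D" "m' \<in> V" unfolding semidirect_def by blast
  then have lm': "l' \<in> carrier R" "l' \<noteq> \<zero>" "m' \<in> carrier R" using DD(1) VD(1) by blast+
  have "l \<otimes> l' \<in> D" "l \<otimes> m' \<oplus> m \<in> V" using DD(3) VD(3,5) g h by blast+
  then show "g \<otimes>\<^bsub>AGL1 R\<^esub> h \<in> semidirect D V"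
    unfolding g(1) h(1) aff_mult[OF lm lm'] semidirect_def by blast
qed

section \<open>Linear and translation parts of a subgroup\<close>

context
  fixes H assumes H: "subgroup H (AGL1 R)"
begin

lemma subgroup_linear_parts: "subgroup (linear_parts H) (mult_of R)"
proof -
  interpret G: group "mult_of R" by (rule field_mult_group)
  show ?thesis
  proof (rule G.subgroupI)
    show "linear_parts H \<subseteq> carrier (mult_of R)" by (auto simp: linear_parts_def)
    have "aff \<one> \<zero> \<in> H" using subgroup.one_closed[OF H] by (simp add: AGL_one)
    then have "\<one> \<in> linear_parts H" by (auto simp: linear_parts_def)
    then show "linear_parts H \<noteq> {}" by blast
  next
    fix a assume "a \<in> linear_parts H"
    then obtain m where a: "a \<in> carrier R" "a \<noteq> \<zero>" "m \<in> carrier R" "aff a m \<in> H"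
      by (auto simp: linear_parts_def)
    note i = inv_nonzero[OF a(1,2)]
    have "aff (inv a) (\<ominus> (inv a \<otimes> m)) \<in> H"
      using subgroup.m_inv_closed[OF H a(4)] by (simp add: AGL_inv a)
    then have "inv a \<in> linear_parts H" using a i by (auto simp: linear_parts_def)
    then show "inv\<^bsub>mult_of R\<^esub> a \<in> linear_parts H" using m_inv_mult_of[of a] a by simp
    fix b assume "b \<in> linear_parts H"
    then obtain k where b: "b \<in> carrier R" "b \<noteq> \<zero>" "k \<in> carrier R" "aff b k \<in> H"
      by (auto simp: linear_parts_def)
    have "aff (a \<otimes> b) (a \<otimes> k \<oplus> m) \<in> H"
      using subgroup.m_closed[OF H a(4) b(4)] by (simp add: aff_mult a b)
    then show "a \<otimes>\<^bsub>mult_of R\<^esub> b \<in> linear_parts H"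
      using a b by (auto simp: linear_parts_def integral_iff)
  qed
qed

lemma lin_subspace_translation_parts: "lin_subspace (linear_parts H) (translation_parts H)"
proof (rule lin_subspaceI)
  show "translation_parts H \<subseteq> carrier R" by (auto simp: translation_parts_def)
  show "\<zero> \<in> translation_parts H"
    using subgroup.one_closed[OF H] by (simp add: AGL_one translation_parts_def)
  fix x assume "x \<in> translation_parts H"
  then have x: "x \<in> carrier R" "aff \<one> x \<in> H" by (auto simp: translation_parts_def)
  show "\<ominus> x \<in> translation_parts H"
    using subgroup.m_inv_closed[OF H x(2)] x(1) by (simp add: AGL_inv translation_parts_def)
  show "k \<otimes> x \<in> translation_parts H" if kH: "k \<in> linear_parts H" for k
  proof -
    obtain m where k: "k \<in> carrier R" "k \<noteq> \<zero>" "m \<in> carrier R" "aff k m \<in> H"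
      using kH by (auto simp: linear_parts_def)
    \<comment> \<open>Conjugating a translation by an element with linear part \<open>k\<close>
      multiplies its vector by \<open>k\<close>, whatever \<open>m\<close> is.\<close>
    have "aff k m \<otimes>\<^bsub>AGL1 R\<^esub> aff \<one> x \<otimes>\<^bsub>AGL1 R\<^esub> inv\<^bsub>AGL1 R\<^esub> (aff k m) \<in> H"
      using subgroup.m_closed[OF H subgroup.m_closed[OF H k(4) x(2)] subgroup.m_inv_closed[OF H k(4)]] .
    then have "aff \<one> (k \<otimes> x \<oplus> (m \<ominus> \<one> \<otimes> m)) \<in> H"
      using aff_conjugate[of k m \<one> x] k x(1) by simp
    moreover have "k \<otimes> x \<oplus> (m \<ominus> \<one> \<otimes> m) = k \<otimes> x" using k x(1) by simp
    ultimately have "aff \<one> (k \<otimes> x) \<in> H" by (simp only:)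
    then show ?thesis using k x(1) by (simp add: translation_parts_def)
  qed
  fix y assume "y \<in> translation_parts H"
  then have y: "y \<in> carrier R" "aff \<one> y \<in> H" by (auto simp: translation_parts_def)
  have "aff \<one> (x \<oplus> y) \<in> H"
    using subgroup.m_closed[OF H y(2) x(2)] x(1) y(1) by (simp add: aff_mult)
  then show "x \<oplus> y \<in> translation_parts H" using x y by (simp add: translation_parts_def)
qed

text \<open>The hypothesis provides, for each linear part of \<open>H\<close>, the element fixing
  zero; these elements form a complement to the translations in \<open>H\<close>.\<close>

lemma eq_semidirect:
  assumes split: "\<And>l. l \<in> linear_parts H \<Longrightarrow> aff l \<zero> \<in> H"
  shows "H = semidirect (linear_parts H) (translation_parts H)"
proof (intro equalityI subsetI)
  fix g assume g: "g \<in> H"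
  then have "g \<in> carrier (AGL1 R)" using subgroup.subset[OF H] by blast
  then obtain l m where lm: "l \<in> carrier R" "l \<noteq> \<zero>" "m \<in> carrier R" "g = aff l m" by (rule AGL_cases)
  note i = inv_nonzero[OF lm(1,2)]
  have l: "l \<in> linear_parts H" using lm g by (auto simp: linear_parts_def)
  have "aff l m \<otimes>\<^bsub>AGL1 R\<^esub> inv\<^bsub>AGL1 R\<^esub> (aff l \<zero>) \<in> H"
    using subgroup.m_closed[OF H _ subgroup.m_inv_closed[OF H split[OF l]]] g lm by simp
  then have "aff \<one> m \<in> H" using lm i by (simp add: AGL_inv aff_mult)
  then show "g \<in> semidirect (linear_parts H) (translation_parts H)"
    unfolding semidirect_def translation_parts_def using l lm by blast
next
  fix g assume "g \<in> semidirect (linear_parts H) (translation_parts H)"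
  then obtain l m where g: "g = aff l m" "l \<in> linear_parts H" "m \<in> translation_parts H"
    unfolding semidirect_def by blast
  then have lm: "l \<in> carrier R" "l \<noteq> \<zero>" "m \<in> carrier R" "aff \<one> m \<in> H"
    by (auto simp: linear_parts_def translation_parts_def)
  have "aff \<one> m \<otimes>\<^bsub>AGL1 R\<^esub> aff l \<zero> \<in> H"
    using subgroup.m_closed[OF H lm(4) split[OF g(2)]] .
  then show "g \<in> H" using lm g(1) by (simp add: aff_mult)
qed

lemma eq_semidirect_carrier:
  assumes "translation_parts H = carrier R"
  shows "H = semidirect (linear_parts H) (carrier R)"
proof -
  have "aff l \<zero> \<in> H" if lH: "l \<in> linear_parts H" for l
  proof -
    obtain m where m: "l \<in> carrier R" "l \<noteq> \<zero>" "m \<in> carrier R" "aff l m \<in> H"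
      using lH by (auto simp: linear_parts_def)
    \<comment> \<open>All translations lie in \<open>H\<close>, so the constant term can be removed
      inside \<open>H\<close>.\<close>
    have "aff \<one> (\<ominus> m) \<in> H" using assms m by (auto simp: translation_parts_def)
    then have "aff \<one> (\<ominus> m) \<otimes>\<^bsub>AGL1 R\<^esub> aff l m \<in> H"
      using subgroup.m_closed[OF H _ m(4)] by blast
    then show ?thesis using m by (simp add: aff_mult r_neg)
  qed
  then show ?thesis using eq_semidirect assms by metis
qed

lemma conjugate_image:
  assumes "a \<in> carrier R" "a \<noteq> \<zero>" "b \<in> carrier R"
  shows "conjugate (AGL1 R) (aff a b) H =
    {aff l (a \<otimes> m \<oplus> (b \<ominus> l \<otimes> b)) | l m. l \<in> carrier R - {\<zero>} \<and> m \<in> carrier R \<and> aff l m \<in> H}"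
    (is "?L = ?R")
proof (intro equalityI subsetI)
  fix g assume "g \<in> ?L"
  then obtain h where h: "h \<in> H"
    "g = aff a b \<otimes>\<^bsub>AGL1 R\<^esub> h \<otimes>\<^bsub>AGL1 R\<^esub> inv\<^bsub>AGL1 R\<^esub> (aff a b)"
    by (auto simp: AGL.conjugate_eq_image)
  have "h \<in> carrier (AGL1 R)" using subgroup.subset[OF H] h by blast
  then obtain l m where "l \<in> carrier R" "l \<noteq> \<zero>" "m \<in> carrier R" "h = aff l m" by (rule AGL_cases)
  then show "g \<in> ?R" using h assms aff_conjugate by blast
next
  fix g assume "g \<in> ?R"
  then obtain l m where "g = aff l (a \<otimes> m \<oplus> (b \<ominus> l \<otimes> b))" "l \<in> carrier R - {\<zero>}"
    "m \<in> carrier R" "aff l m \<in> H" by blast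
  moreover from this have "g = aff a b \<otimes>\<^bsub>AGL1 R\<^esub> aff l m \<otimes>\<^bsub>AGL1 R\<^esub> inv\<^bsub>AGL1 R\<^esub> (aff a b)"
    using aff_conjugate[OF assms, of l m] by simp
  ultimately show "g \<in> ?L" unfolding AGL.conjugate_eq_image by blast
qed

lemma linear_parts_conjugate:
  assumes "g \<in> carrier (AGL1 R)"
  shows "linear_parts (conjugate (AGL1 R) g H) = linear_parts H"
proof -
  obtain a b where g: "a \<in> carrier R" "a \<noteq> \<zero>" "b \<in> carrier R" "g = aff a b"
    using assms by (rule AGL_cases)
  let ?X = "{aff l (a \<otimes> m \<oplus> (b \<ominus> l \<otimes> b)) | l m. l \<in> carrier R - {\<zero>} \<and> m \<in> carrier R \<and> aff l m \<in> H}"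
  have "linear_parts ?X = linear_parts H"
  proof (intro equalityI subsetI)
    fix l
    assume "l \<in> linear_parts ?X"
    then obtain m' l' m where *: "l \<in> carrier R - {\<zero>}" "m' \<in> carrier R" "l' \<in> carrier R - {\<zero>}"
      "m \<in> carrier R" "aff l' m \<in> H" "aff l m' = aff l' (a \<otimes> m \<oplus> (b \<ominus> l' \<otimes> b))"
      unfolding linear_parts_def by blast
    then have "l = l'" using g aff_eq_iff[of l m' l' "a \<otimes> m \<oplus> (b \<ominus> l' \<otimes> b)"] by simp
    then show "l \<in> linear_parts H" using * unfolding linear_parts_def by blast
  next
    fix l
    assume "l \<in> linear_parts H"
    then obtain m where *: "l \<in> carrier R - {\<zero>}" "m \<in> carrier R" "aff l m \<in> H"
      unfolding linear_parts_def by blast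
    moreover have "a \<otimes> m \<oplus> (b \<ominus> l \<otimes> b) \<in> carrier R" using * g by simp
    ultimately show "l \<in> linear_parts ?X" unfolding linear_parts_def by blast
  qed
  then show ?thesis by (simp only: g(4) conjugate_image[OF g(1-3)])
qed

lemma translation_parts_conjugate:
  assumes a: "a \<in> carrier R" "a \<noteq> \<zero>" and b: "b \<in> carrier R"
  shows "translation_parts (conjugate (AGL1 R) (aff a b) H) = (\<lambda>m. a \<otimes> m) ` translation_parts H"
proof (intro equalityI subsetI)
  have simps: "a \<otimes> m \<oplus> (b \<ominus> \<one> \<otimes> b) = a \<otimes> m" if "m \<in> carrier R" for m
    using a b that by simp
  {
    fix x assume "x \<in> translation_parts (conjugate (AGL1 R) (aff a b) H)"
    then obtain l m where *: "x \<in> carrier R" "l \<in> carrier R - {\<zero>}" "m \<in> carrier R" "aff l m \<in> H"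
      "aff \<one> x = aff l (a \<otimes> m \<oplus> (b \<ominus> l \<otimes> b))"
      unfolding translation_parts_def conjugate_image[OF assms] by blast
    then have "l = \<one> \<and> x = a \<otimes> m \<oplus> (b \<ominus> l \<otimes> b)"
      using a b aff_eq_iff[of \<one> x l "a \<otimes> m \<oplus> (b \<ominus> l \<otimes> b)"] by simp
    then show "x \<in> (\<lambda>m. a \<otimes> m) ` translation_parts H"
      using * simps by (auto simp: translation_parts_def)
  next
    fix x assume "x \<in> (\<lambda>m. a \<otimes> m) ` translation_parts H"
    then obtain m where *: "x = a \<otimes> m" "m \<in> carrier R" "aff \<one> m \<in> H" by (auto simp: translation_parts_def)
    then have "aff \<one> x = aff \<one> (a \<otimes> m \<oplus> (b \<ominus> \<one> \<otimes> b))" using simps by simp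
    then have "aff \<one> x \<in> conjugate (AGL1 R) (aff a b) H"
      unfolding conjugate_image[OF assms] using *
      by (intro CollectI exI[of _ \<one>] exI[of _ m]) auto
    then show "x \<in> translation_parts (conjugate (AGL1 R) (aff a b) H)"
      using * a by (simp add: translation_parts_def)
  }
qed

end

text \<open>The linear parts are the powers of one element, so it suffices that a lift of this
  element fixes zero; its powers then lift all the others.\<close>

lemma exists_conjugate_eq_semidirect:
  assumes H: "subgroup H (AGL1 R)"
  obtains c where "c \<in> carrier R"
    "conjugate (AGL1 R) (aff \<one> c) H = semidirect (linear_parts H) (translation_parts H)"
proof -
  let ?D = "linear_parts H"
  have D: "subgroup ?D (mult_of R)" by (rule subgroup_linear_parts[OF H])
  note DD = mult_subgroupD[OF D]
  obtain b where b: "b \<in> carrier R" "inj_on (\<lambda>j::nat. b [^] j) {..<card ?D}"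
    "?D = (\<lambda>j. b [^] j) ` {..<card ?D}"
    using unity_roots_cyclic[OF mult_subgroup_eq_unity_roots(1)[OF D]]
      mult_subgroup_eq_unity_roots(2)[OF D] by metis
  have "\<exists>c\<in>carrier R. \<forall>l\<in>?D. aff l \<zero> \<in> conjugate (AGL1 R) (aff \<one> c) H"
  proof (cases "card ?D \<ge> 2")
    \<comment> \<open>With trivial linear part \<open>\<one> \<ominus> b\<close> is not invertible,
      but the identity already fixes zero.\<close>
    case False
    have fD: "finite ?D" using DD(1) finite_carrier by (meson finite_Diff finite_subset)
    have "card ?D \<noteq> 0" using fD DD(2) by auto
    then have "?D = {\<one>}" using False DD(2) card_1_singletonE[of ?D] by force
    moreover have c: "subgroup (conjugate (AGL1 R) (aff \<one> \<zero>) H) (AGL1 R)"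
      using AGL.subgroup_conjugateI[OF H] aff_in_AGL[of \<one> \<zero>] by simp
    ultimately show ?thesis using subgroup.one_closed[OF c] by (auto simp: AGL_one)
  next
    case True
    have "b [^] (1::nat) \<in> ?D" by (subst b(3), rule imageI) (use True in simp)
    moreover have "b [^] (1::nat) \<noteq> b [^] (0::nat)"
      using True inj_onD[OF b(2), of 1 0] by auto
    ultimately have bD: "b \<in> ?D" "b \<noteq> \<one>" using b(1) by simp_all
    then obtain m where m: "m \<in> carrier R" "b \<noteq> \<zero>" "aff b m \<in> H" by (auto simp: linear_parts_def)
    have nz: "\<one> \<ominus> b \<in> carrier R" "\<one> \<ominus> b \<noteq> \<zero>" using b(1) bD(2) by auto
    note i = inv_nonzero[OF nz]
    \<comment> \<open>The solution of
      \<open>m \<oplus> (\<one> \<ominus> b) \<otimes> c = \<zero>\<close>, the negative of the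
      fixed point of \<open>aff b m\<close>.\<close>
    define c where "c = \<ominus> (inv (\<one> \<ominus> b) \<otimes> m)"
    have c: "c \<in> carrier R" using i m by (simp add: c_def)
    have "\<one> \<otimes> m \<oplus> (c \<ominus> b \<otimes> c) = m \<oplus> (\<one> \<ominus> b) \<otimes> c"
      using b(1) c m by algebra
    also have "(\<one> \<ominus> b) \<otimes> c = \<ominus> (((\<one> \<ominus> b) \<otimes> inv (\<one> \<ominus> b)) \<otimes> m)"
      unfolding c_def using nz(1) i(1) m(1) by (simp add: r_minus m_assoc)
    also have "\<dots> = \<ominus> m" using i(4) m(1) by simp
    finally have eq: "\<one> \<otimes> m \<oplus> (c \<ominus> b \<otimes> c) = \<zero>" using m(1) by (simp add: r_neg)
    let ?H = "conjugate (AGL1 R) (aff \<one> c) H"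
    have sub: "subgroup ?H (AGL1 R)"
      using AGL.subgroup_conjugateI[OF H] aff_in_AGL[of \<one> c] c by simp
    have "aff b (\<one> \<otimes> m \<oplus> (c \<ominus> b \<otimes> c)) \<in> ?H"
      unfolding conjugate_image[OF H one_closed one_not_zero c] using m b(1) by blast
    then have b0: "aff b \<zero> \<in> ?H" unfolding eq .
    have "aff (b [^] j) \<zero> \<in> ?H \<and> b [^] j \<noteq> \<zero>" for j :: nat
    proof (induction j)
      case 0
      show ?case using subgroup.one_closed[OF sub] by (simp add: AGL_one)
    next
      case (Suc j)
      then have "aff (b [^] j) \<zero> \<otimes>\<^bsub>AGL1 R\<^esub> aff b \<zero> \<in> ?H"
        using subgroup.m_closed[OF sub] b0 by blast
      then show ?case using Suc b(1) m(2) by (simp add: aff_mult integral_iff)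
    qed
    then have "\<forall>l\<in>?D. aff l \<zero> \<in> ?H" by (subst b(3)) blast
    then show ?thesis using c by blast
  qed
  then obtain c where c: "c \<in> carrier R" "\<forall>l\<in>?D. aff l \<zero> \<in> conjugate (AGL1 R) (aff \<one> c) H" by blast
  let ?H = "conjugate (AGL1 R) (aff \<one> c) H"
  have g: "aff \<one> c \<in> carrier (AGL1 R)" using aff_in_AGL[of \<one> c] c by simp
  have sub: "subgroup ?H (AGL1 R)" using AGL.subgroup_conjugateI[OF H g] .
  have lin: "linear_parts ?H = ?D" using linear_parts_conjugate[OF H g] .
  have "translation_parts H \<subseteq> carrier R" by (auto simp: translation_parts_def)
  then have "translation_parts ?H = translation_parts H"
    using translation_parts_conjugate[OF H one_closed one_not_zero c(1)] by (auto simp: subset_iff image_iff)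
  then have "?H = semidirect ?D (translation_parts H)"
    using eq_semidirect[OF sub] c(2) lin by simp
  then show thesis using that c(1) by blast
qed

section \<open>Subgroups containing all translations\<close>

lemma lin_subspace_carrier: "D \<subseteq> carrier R \<Longrightarrow> lin_subspace D (carrier R)"
  by (rule lin_subspaceI) auto

lemma unity_roots_subset: "unity_roots e \<subseteq> carrier R - {\<zero>}"
  by (auto simp: unity_roots_def)

lemma semidirect_unity_roots:
  shows "subgroup (semidirect (unity_roots e) (carrier R)) (AGL1 R)"
    "linear_parts (semidirect (unity_roots e) (carrier R)) = unity_roots e"
    "translation_parts (semidirect (unity_roots e) (carrier R)) = carrier R"
    "semidirect (unity_roots d) (carrier R) \<inter> semidirect (unity_roots e) (carrier R) =
      semidirect (unity_roots (gcd d e)) (carrier R)"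
proof -
  show "subgroup (semidirect (unity_roots e) (carrier R)) (AGL1 R)"
    using unity_roots_subset by (intro subgroup_semidirect subgroup_unity_roots lin_subspace_carrier) blast
  show "linear_parts (semidirect (unity_roots e) (carrier R)) = unity_roots e"
    using unity_roots_subset by (intro linear_parts_semidirect) auto
  show "translation_parts (semidirect (unity_roots e) (carrier R)) = carrier R"
    using unity_roots_subset by (intro translation_parts_semidirect) (auto simp: unity_roots_def)
  show "semidirect (unity_roots d) (carrier R) \<inter> semidirect (unity_roots e) (carrier R) =
      semidirect (unity_roots (gcd d e)) (carrier R)"
    using semidirect_Int[of "unity_roots d" "carrier R" "unity_roots e" "carrier R"]
      unity_roots_subset unity_roots_Int by auto
qed

lemma semidirect_unity_roots_eqD:
  assumes "semidirect (unity_roots d) (carrier R) = semidirect (unity_roots e) (carrier R)"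
    "d dvd card (carrier R) - 1" "e dvd card (carrier R) - 1"
  shows "d = e"
  using assms semidirect_unity_roots(2) card_unity_roots by metis

lemma semidirect_unity_roots_order:
  "semidirect (unity_roots (card (carrier R) - 1)) (carrier R) = carrier (AGL1 R)"
proof -
  have "unity_roots (card (carrier R) - 1) = carrier R - {\<zero>}"
    using card_unity_roots[of "card (carrier R) - 1"] unity_roots_subset finite_carrier
    by (intro card_subset_eq) auto
  then show ?thesis by (simp add: carrier_AGL)
qed

lemma subgroup_eq_semidirect_unity_roots:
  assumes H: "subgroup H (AGL1 R)" and T: "translation_parts H = carrier R"
  shows "H = semidirect (unity_roots (card (linear_parts H))) (carrier R)"
    "card (linear_parts H) dvd card (carrier R) - 1"
  using eq_semidirect_carrier[OF H T] mult_subgroup_eq_unity_roots[OF subgroup_linear_parts[OF H]]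
  by simp_all

lemma translation_parts_mono: "A \<subseteq> B \<Longrightarrow> translation_parts A \<subseteq> translation_parts B"
  by (auto simp: translation_parts_def)

lemma linear_parts_mono: "A \<subseteq> B \<Longrightarrow> linear_parts A \<subseteq> linear_parts B"
  by (auto simp: linear_parts_def)

lemma translation_parts_subset: "translation_parts A \<subseteq> carrier R"
  by (auto simp: translation_parts_def)

text \<open>Overgroups also contain all translations, so they are given by orders of linear parts,
  and intersections become gcds. \<open>m\<close> is the index; the whole group has
  \<open>m = 1\<close>, which is not a prime power.\<close>

lemma meet_irreducible_unity_roots_iff:
  assumes N: "card (carrier R) - 1 = e * m"
  shows "meet_irreducible (AGL1 R) (semidirect (unity_roots e) (carrier R)) \<longleftrightarrow> primepow m"
    (is "meet_irreducible _ (?S e) \<longleftrightarrow> _")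
proof
  let ?N = "card (carrier R) - 1"
  have pos: "?N > 0" using order_gt_one by simp
  then have "e * m > 0" by (simp only: N)
  then have e: "e > 0" "m > 0" "e dvd ?N" using N by simp_all
  {
    assume irr: "meet_irreducible (AGL1 R) (?S e)"
    then have "m \<noteq> 1" using semidirect_unity_roots_order N by (auto simp: meet_irreducible_def)
    then have m: "m > 1" using e by simp
    show "primepow m"
    proof (rule ccontr)
      assume "\<not> primepow m"
      then obtain a b where ab: "m = a * b" "coprime a b" "a > 1" "b > 1"
        using not_primepow_coprime_factors m by blast
      have dvd: "e * a dvd ?N" "e * b dvd ?N" using N ab by auto
      \<comment> \<open>Coprime factors of the index give two strictly larger subgroups meeting in
        \<open>?S e\<close>.\<close>
      have "gcd (e * a) (e * b) = e" using ab(2) by (simp add: gcd_mult_distrib_nat[symmetric])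
      then have "?S (e * a) \<inter> ?S (e * b) = ?S e" using semidirect_unity_roots(4) by metis
      then have "?S (e * a) = ?S e \<or> ?S (e * b) = ?S e"
        using irr semidirect_unity_roots(1) unfolding meet_irreducible_def by blast
      then have "e * a = e \<or> e * b = e" using semidirect_unity_roots_eqD dvd e(3) by blast
      then show False using ab e by simp
    qed
  next
    assume m: "primepow m"
    show "meet_irreducible (AGL1 R) (?S e)"
      unfolding meet_irreducible_def
    proof (intro conjI allI impI)
      show "subgroup (?S e) (AGL1 R)" by (rule semidirect_unity_roots)
      show "?S e \<noteq> carrier (AGL1 R)"
      proof
        assume "?S e = carrier (AGL1 R)"
        then have "e = ?N" using semidirect_unity_roots_eqD[of e ?N] semidirect_unity_roots_order e by simp
        then have "m = 1" using N e by simp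
        then show False using m by simp
      qed
      fix A B assume AB: "subgroup A (AGL1 R)" "subgroup B (AGL1 R)" "A \<inter> B = ?S e"
      have T: "translation_parts A = carrier R" "translation_parts B = carrier R"
        using translation_parts_mono[of "?S e" A] translation_parts_mono[of "?S e" B] AB(3)
          semidirect_unity_roots(3)[of e] translation_parts_subset by blast+
      let ?a = "card (linear_parts A)" and ?b = "card (linear_parts B)"
      note A = subgroup_eq_semidirect_unity_roots[OF AB(1) T(1)]
      note B = subgroup_eq_semidirect_unity_roots[OF AB(2) T(2)]
      have "?S (gcd ?a ?b) = ?S e" using AB(3) A(1) B(1) semidirect_unity_roots(4) by metis
      moreover have "gcd ?a ?b dvd ?N" using A(2) by (meson dvd_trans gcd_dvd1)
      ultimately have gcd: "gcd ?a ?b = e" using semidirect_unity_roots_eqD e(3) by blast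
      \<comment> \<open>After division by \<open>e\<close> the orders become coprime divisors of the
        prime power \<open>m\<close>, so one of them is 1.\<close>
      then obtain a' b' where a': "?a = e * a'" "?b = e * b'" by (metis dvdE gcd_dvd1 gcd_dvd2)
      have "e * gcd a' b' = e" using gcd a' by (simp add: gcd_mult_distrib_nat)
      then have "coprime a' b'" using e by (simp add: coprime_iff_gcd_eq_1)
      moreover have "a' dvd m" "b' dvd m" using A(2) B(2) N a' e by simp_all
      ultimately have "a' = 1 \<or> b' = 1" using coprime_dvd_primepow[OF m] by blast
      then have "?a = e \<or> ?b = e" using a' by auto
      then show "A = ?S e \<or> B = ?S e" using A(1) B(1) by metis
    qed
  }
qed

section \<open>Subgroups attached to subfields and hyperplanes\<close>

lemma subfield_subgroupD:
  assumes "subfield K R"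
  shows "K - {\<zero>} \<subseteq> carrier R - {\<zero>}" "\<one> \<in> K - {\<zero>}" "K - {\<zero>} \<subseteq> carrier R"
  using mult_subgroupD(1,2)[OF subgroup_mult_of[OF assms]] by auto

lemma lin_subspace_Diff_zero:
  assumes "lin_subspace (K - {\<zero>}) V"
  shows "lin_subspace K V"
proof -
  note VD = lin_subspaceD[OF assms]
  have "k \<otimes> x \<in> V" if "k \<in> K" "x \<in> V" for k x
    using VD(5)[of k x] VD(1,2) that by (cases "k = \<zero>") auto
  then show ?thesis using assms by (simp add: lin_subspace_def)
qed

lemma lin_subspace_antimono: "lin_subspace K V \<Longrightarrow> D \<subseteq> K \<Longrightarrow> lin_subspace D V"
  by (auto simp: lin_subspace_def)

lemma subgroup_semidirect_subfield:
  assumes "subfield K R" "lin_subspace K V"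
  shows "subgroup (semidirect (K - {\<zero>}) V) (AGL1 R)"
    "linear_parts (semidirect (K - {\<zero>}) V) = K - {\<zero>}"
    "translation_parts (semidirect (K - {\<zero>}) V) = V"
proof -
  note VD = lin_subspaceD[OF assms(2)] and KD = subfield_subgroupD[OF assms(1)]
  show "subgroup (semidirect (K - {\<zero>}) V) (AGL1 R)"
    by (intro subgroup_semidirect subgroup_mult_of assms lin_subspace_antimono[OF assms(2)]) blast
  show "linear_parts (semidirect (K - {\<zero>}) V) = K - {\<zero>}"
    using KD VD by (intro linear_parts_semidirect) auto
  show "translation_parts (semidirect (K - {\<zero>}) V) = V"
    using KD VD by (intro translation_parts_semidirect) auto
qed

text \<open>By maximality of \<open>V\<close> the translations of \<open>A\<close> are
  \<open>V\<close> or everything. In the first case the linear parts of \<open>A\<close> stabilize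
  \<open>V\<close>, hence lie in \<open>K\<close>, and \<open>A\<close> is no larger than the given
  group.\<close>

lemma translation_parts_overgroup:
  assumes K: "subfield K R" and V: "maximal_subspace K V"
    and A: "subgroup A (AGL1 R)" "semidirect (K - {\<zero>}) V \<subseteq> A" "A \<noteq> semidirect (K - {\<zero>}) V"
  shows "translation_parts A = carrier R"
proof (rule ccontr)
  assume no: "\<not> ?thesis"
  have V': "lin_subspace K V" using V by (simp add: maximal_subspace_def)
  note S = subgroup_semidirect_subfield[OF K V']
  have sub: "K - {\<zero>} \<subseteq> linear_parts A" "V \<subseteq> translation_parts A"
    using linear_parts_mono[OF A(2)] translation_parts_mono[OF A(2)] S by auto
  note TA = lin_subspace_translation_parts[OF A(1)]
  have "lin_subspace K (translation_parts A)"
    by (rule lin_subspace_Diff_zero[OF lin_subspace_antimono[OF TA sub(1)]])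
  then have T: "translation_parts A = V"
    using V sub(2) no unfolding maximal_subspace_def by blast
  have "linear_parts A \<subseteq> stabilizer V"
    using lin_subspaceD(5)[OF TA] unfolding T by (auto simp: stabilizer_def linear_parts_def)
  then have L: "linear_parts A = K - {\<zero>}"
    using stabilizer_maximal_subspace[OF K V] sub(1) by (auto simp: linear_parts_def)
  have "aff l \<zero> \<in> A" if "l \<in> linear_parts A" for l
  proof -
    have "aff l \<zero> \<in> semidirect (K - {\<zero>}) V"
      using that L lin_subspaceD(2)[OF V'] unfolding semidirect_def by blast
    then show ?thesis using A(2) by blast
  qed
  then have "A = semidirect (K - {\<zero>}) V" using eq_semidirect[OF A(1)] L T by simp
  then show False using A(3) by simp
qed

text \<open>Two strictly larger subgroups contain all translations, hence so does their
  intersection, while \<open>V\<close> is proper.\<close>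

lemma meet_irreducible_semidirect_subfield:
  assumes K: "subfield K R" and V: "maximal_subspace K V"
  shows "meet_irreducible (AGL1 R) (semidirect (K - {\<zero>}) V)"
  unfolding meet_irreducible_def
proof (intro conjI allI impI)
  let ?S = "semidirect (K - {\<zero>}) V"
  have V': "lin_subspace K V" "V \<noteq> carrier R" using V by (auto simp: maximal_subspace_def)
  note S = subgroup_semidirect_subfield[OF K V'(1)]
  show "subgroup ?S (AGL1 R)" by (rule S)
  have "translation_parts (carrier (AGL1 R)) = carrier R"
    using aff_in_AGL[of \<one>] by (auto simp: translation_parts_def)
  then show "?S \<noteq> carrier (AGL1 R)" using S(3) V'(2) by auto
  fix A B assume AB: "subgroup A (AGL1 R)" "subgroup B (AGL1 R)" "A \<inter> B = ?S"
  show "A = ?S \<or> B = ?S"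
  proof (rule ccontr)
    assume "\<not> ?thesis"
    then have "translation_parts A = carrier R" "translation_parts B = carrier R"
      using translation_parts_overgroup[OF K V] AB by blast+
    then have "carrier R \<subseteq> translation_parts (A \<inter> B)" by (auto simp: translation_parts_def)
    then have "carrier R \<subseteq> V" using AB(3) S(3) by simp
    then show False using lin_subspaceD(1)[OF V'(1)] V'(2) by blast
  qed
qed

lemma meet_irreducible_conjugate_semidirect:
  assumes H: "meet_irreducible (AGL1 R) H" and T: "translation_parts H \<noteq> carrier R"
  obtains K V g where "subfield K R" "maximal_subspace K V" "g \<in> carrier (AGL1 R)"
    "conjugate (AGL1 R) g H = semidirect (K - {\<zero>}) V" "linear_parts H = K - {\<zero>}"
proof -
  let ?D = "linear_parts H" and ?V = "translation_parts H"
  have Hs: "subgroup H (AGL1 R)" using H by (simp add: meet_irreducible_def)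
  obtain c where c: "c \<in> carrier R" "conjugate (AGL1 R) (aff \<one> c) H = semidirect ?D ?V"
    using exists_conjugate_eq_semidirect[OF Hs] by blast
  have g: "aff \<one> c \<in> carrier (AGL1 R)" using aff_in_AGL[of \<one> c] c by simp
  have irr: "meet_irreducible (AGL1 R) (semidirect ?D ?V)"
    using AGL.meet_irreducible_conjugate[OF H g] c(2) by simp
  have D: "subgroup ?D (mult_of R)" by (rule subgroup_linear_parts[OF Hs])
  note DD = mult_subgroupD[OF D]
  have V: "lin_subspace ?D ?V" by (rule lin_subspace_translation_parts[OF Hs])
  then have add: "additive_subgroup ?V R" by (simp add: lin_subspace_def)
  define K where "K = stabilizer ?V"
  have K: "subfield K R" unfolding K_def by (rule subfield_stabilizer[OF add])
  have KV: "lin_subspace K ?V" unfolding K_def by (rule lin_subspace_stabilizer[OF add])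
  have DK: "?D \<subseteq> K - {\<zero>}"
    unfolding K_def stabilizer_def using DD(1) lin_subspaceD(5)[OF V] by blast
  have KR: "K - {\<zero>} \<subseteq> carrier R" using subfield_subgroupD[OF K] by blast
  have VR: "?V \<subseteq> carrier R" by (rule translation_parts_subset)
  have DR: "?D \<subseteq> carrier R" using DD(1) by blast
  \<comment> \<open>Enlarging the linear part to the stabilizer and enlarging the translations to
    the whole field give two overgroups meeting in the original group. The second one differs from
    it by \<open>T\<close>, so the first one must equal it.\<close>
  have "semidirect (K - {\<zero>}) ?V \<inter> semidirect ?D (carrier R) = semidirect ?D ?V"
    using semidirect_Int[OF KR VR DR order_refl] DK VR by (simp add: Int_absorb1 Int_absorb2)
  then have "semidirect (K - {\<zero>}) ?V = semidirect ?D ?V \<or> semidirect ?D (carrier R) = semidirect ?D ?V"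
    using irr subgroup_semidirect_subfield(1)[OF K KV]
      subgroup_semidirect[OF D lin_subspace_carrier[OF DR]] unfolding meet_irreducible_def by blast
  moreover have "semidirect ?D (carrier R) \<noteq> semidirect ?D ?V"
    using translation_parts_semidirect[OF DD(1) order_refl DD(2)]
      translation_parts_semidirect[OF DD(1) VR DD(2)] T by metis
  ultimately have eq: "semidirect ?D ?V = semidirect (K - {\<zero>}) ?V" by simp
  then have DeqK: "?D = K - {\<zero>}"
    using subgroup_semidirect_subfield(2)[OF K KV] linear_parts_semidirect[OF DD(1) VR]
      lin_subspaceD(2)[OF V] by (metis empty_iff)
  have "maximal_subspace K ?V"
  proof (rule maximal_subspace_if_meet_irreducible[OF K KV T])
    fix U W assume UW: "lin_subspace K U" "lin_subspace K W" "U \<inter> W = ?V"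
    \<comment> \<open>With the linear part fixed, intersecting subgroups means intersecting
      subspaces, so the translation part inherits meet-irreducibility.\<close>
    have "semidirect (K - {\<zero>}) U \<inter> semidirect (K - {\<zero>}) W = semidirect (K - {\<zero>}) ?V"
      using semidirect_Int[OF KR lin_subspaceD(1)[OF UW(1)] KR lin_subspaceD(1)[OF UW(2)]] UW(3) by simp
    then have "semidirect (K - {\<zero>}) U = semidirect (K - {\<zero>}) ?V \<or>
        semidirect (K - {\<zero>}) W = semidirect (K - {\<zero>}) ?V"
      using irr subgroup_semidirect_subfield(1)[OF K] UW(1,2) unfolding eq meet_irreducible_def by blast
    then show "U = ?V \<or> W = ?V"
      using subgroup_semidirect_subfield(3)[OF K] UW(1,2) KV by metis
  qed
  then show thesis using that[OF K _ g] c(2) eq DeqK by metis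
qed

lemma semidirect_conjugate_maximal_subspaces:
  assumes K: "subfield K R" and V: "maximal_subspace K V" and W: "maximal_subspace K W"
  obtains g where "g \<in> carrier (AGL1 R)"
    "semidirect (K - {\<zero>}) W = conjugate (AGL1 R) g (semidirect (K - {\<zero>}) V)"
proof -
  \<comment> \<open>Conjugation by the homothety \<open>aff a \<zero>\<close> multiplies the
    translation part by \<open>a\<close> and keeps the linear part.\<close>
  obtain a where a: "a \<in> carrier R" "a \<noteq> \<zero>" "W = (\<lambda>v. a \<otimes> v) ` V"
    using maximal_subspaces_scale[OF K W V] by blast
  have V': "lin_subspace K V" using V by (simp add: maximal_subspace_def)
  note S = subgroup_semidirect_subfield[OF K V']
  have KR: "K - {\<zero>} \<subseteq> carrier R" "K - {\<zero>} \<subseteq> carrier R - {\<zero>}" using subfield_subgroupD[OF K] by blast+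
  have VR: "V \<subseteq> carrier R" using lin_subspaceD(1)[OF V'] .
  have simps: "a \<otimes> m \<oplus> (\<zero> \<ominus> l \<otimes> \<zero>) = a \<otimes> m" if "m \<in> carrier R" "l \<in> carrier R" for m l
    using a that by (simp add: a_minus_def)
  have "conjugate (AGL1 R) (aff a \<zero>) (semidirect (K - {\<zero>}) V) =
    {aff l (a \<otimes> m \<oplus> (\<zero> \<ominus> l \<otimes> \<zero>)) | l m. l \<in> carrier R - {\<zero>} \<and> m \<in> carrier R \<and> aff l m \<in> semidirect (K - {\<zero>}) V}"
    by (rule conjugate_image[OF S(1) a(1,2) zero_closed])
  also have "\<dots> = {aff l (a \<otimes> m) | l m. l \<in> carrier R - {\<zero>} \<and> m \<in> carrier R \<and> l \<in> K - {\<zero>} \<and> m \<in> V}"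
    using simps semidirect_mem_iff[OF KR(1) VR] by (metis (no_types, lifting) DiffD1)
  also have "\<dots> = semidirect (K - {\<zero>}) W"
    unfolding semidirect_def a(3) using KR(2) VR by blast
  finally show thesis using that[of "aff a \<zero>"] aff_in_AGL[OF a(1,2)] by simp
qed

text \<open>The flag is essential: the units of a subfield can be the linear part both of a group
  with all translations and of one with a hyperplane of translations.\<close>

definition class_invariant :: "('a \<Rightarrow> 'a) set \<Rightarrow> nat \<times> bool" where
  "class_invariant H = (card (linear_parts H), translation_parts H = carrier R)"

lemma class_invariant_conjugate:
  assumes H: "subgroup H (AGL1 R)" and g: "g \<in> carrier (AGL1 R)"
  shows "class_invariant (conjugate (AGL1 R) g H) = class_invariant H"
proof -
  obtain a b where ab: "a \<in> carrier R" "a \<noteq> \<zero>" "b \<in> carrier R" "g = aff a b"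
    using g by (rule AGL_cases)
  let ?T = "translation_parts H"
  have "m \<in> carrier R" if "m \<in> ?T" for m using translation_parts_subset that by blast
  then have "card ((\<lambda>m. a \<otimes> m) ` ?T) = card ?T"
    using ab(1,2) m_lcancel by (intro card_image) (auto intro!: inj_onI)
  moreover have "X = carrier R \<longleftrightarrow> card X = card (carrier R)" if "X \<subseteq> carrier R" for X
    using that finite_carrier card_subset_eq by blast
  moreover have "(\<lambda>m. a \<otimes> m) ` ?T \<subseteq> carrier R" using ab translation_parts_subset[of H] by auto
  ultimately have "(\<lambda>m. a \<otimes> m) ` ?T = carrier R \<longleftrightarrow> ?T = carrier R"
    using translation_parts_subset[of H] by simp
  then show ?thesis
    using linear_parts_conjugate[OF H g] translation_parts_conjugate[OF H ab(1-3)] ab(4)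
    by (simp add: class_invariant_def)
qed

lemma class_invariant_eq_iff:
  assumes A: "meet_irreducible (AGL1 R) A" and B: "meet_irreducible (AGL1 R) B"
  shows "class_invariant A = class_invariant B \<longleftrightarrow>
    (\<exists>g\<in>carrier (AGL1 R). B = conjugate (AGL1 R) g A)"
proof
  have As: "subgroup A (AGL1 R)" and Bs: "subgroup B (AGL1 R)"
    using A B by (simp_all add: meet_irreducible_def)
  have sub: "A \<subseteq> carrier (AGL1 R)" "B \<subseteq> carrier (AGL1 R)" using As Bs subgroup.subset by blast+
  {
    assume "\<exists>g\<in>carrier (AGL1 R). B = conjugate (AGL1 R) g A"
    then show "class_invariant A = class_invariant B" using class_invariant_conjugate[OF As] by auto
  next
    assume eq: "class_invariant A = class_invariant B"
    show "\<exists>g\<in>carrier (AGL1 R). B = conjugate (AGL1 R) g A"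
    proof (cases "translation_parts A = carrier R")
      case True
      \<comment> \<open>With all translations present, the order of the linear part determines the
        subgroup itself, not only its class.\<close>
      then have "A = B"
        using eq subgroup_eq_semidirect_unity_roots(1)[OF As] subgroup_eq_semidirect_unity_roots(1)[OF Bs]
        by (simp add: class_invariant_def)
      then show ?thesis using AGL.conjugate_one[OF sub(1)] AGL.one_closed by metis
    next
      case False
      then have FB: "translation_parts B \<noteq> carrier R" using eq by (simp add: class_invariant_def)
      obtain K V g where KV: "subfield K R" "maximal_subspace K V" "g \<in> carrier (AGL1 R)"
        "conjugate (AGL1 R) g A = semidirect (K - {\<zero>}) V" "linear_parts A = K - {\<zero>}"
        using meet_irreducible_conjugate_semidirect[OF A False] by blast
      obtain L W h where LW: "subfield L R" "maximal_subspace L W" "h \<in> carrier (AGL1 R)"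
        "conjugate (AGL1 R) h B = semidirect (L - {\<zero>}) W" "linear_parts B = L - {\<zero>}"
        using meet_irreducible_conjugate_semidirect[OF B FB] by blast
      have "card (K - {\<zero>}) = card (L - {\<zero>})" using eq KV(5) LW(5) by (simp add: class_invariant_def)
      moreover have "card K = Suc (card (K - {\<zero>}))" if "subfield K R" for K
        using subringE(2)[OF subfieldE(1)[OF that]] subfieldE(3)[OF that] finite_carrier
        by (intro card.remove) (auto intro: finite_subset)
      \<comment> \<open>A subfield is determined by its order, so \<open>V\<close> and
        \<open>W\<close> are hyperplanes over the same field and the two semidirect products are
        conjugate.\<close>
      ultimately have "K = L" using subfield_eq_if_card_eq[OF KV(1) LW(1)] KV(1) LW(1) by simp
      then obtain k where k: "k \<in> carrier (AGL1 R)"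
        "semidirect (L - {\<zero>}) W = conjugate (AGL1 R) k (semidirect (K - {\<zero>}) V)"
        using semidirect_conjugate_maximal_subspaces[OF KV(1,2)] LW(2) by blast
      let ?i = "inv\<^bsub>AGL1 R\<^esub> h"
      have "conjugate (AGL1 R) h B = conjugate (AGL1 R) (k \<otimes>\<^bsub>AGL1 R\<^esub> g) A"
        using LW(4) k KV(3,4) AGL.conjugate_conjugate[OF k(1) KV(3) sub(1)] by simp
      then have "B = conjugate (AGL1 R) ?i (conjugate (AGL1 R) (k \<otimes>\<^bsub>AGL1 R\<^esub> g) A)"
        using AGL.conjugate_inv_conjugate[OF LW(3) sub(2)] by simp
      also have "\<dots> = conjugate (AGL1 R) (?i \<otimes>\<^bsub>AGL1 R\<^esub> (k \<otimes>\<^bsub>AGL1 R\<^esub> g)) A"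
        using KV(3) LW(3) k(1) sub(1) by (intro AGL.conjugate_conjugate) auto
      finally show ?thesis using KV(3) LW(3) k(1) by blast
    qed
  }
qed

text \<open>The first family is parametrised by the index \<open>m\<close>, since it is the index
  that must be a prime power; the second by the exponent \<open>d\<close> in the order p^d of the
  subfield.\<close>

lemma class_invariant_image:
  assumes p: "Factorial_Ring.prime p" and n: "n \<ge> 1" and q: "card (carrier R) = p ^ n"
  shows "class_invariant ` {M. meet_irreducible (AGL1 R) M} =
    (\<lambda>m. ((p ^ n - 1) div m, True)) ` {m. primepow m \<and> m dvd p ^ n - 1} \<union>
    (\<lambda>d. (p ^ d - 1, False)) ` {d. d dvd n}" (is "?L = ?A \<union> ?B")
proof (intro equalityI subsetI)
  let ?N = "p ^ n - 1"
  have N: "card (carrier R) - 1 = ?N" using q by simp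
  have pos: "?N > 0" using order_gt_one N by simp
  fix y assume "y \<in> ?L"
  then obtain H where H: "meet_irreducible (AGL1 R) H" "y = class_invariant H" by blast
  then have Hs: "subgroup H (AGL1 R)" by (simp add: meet_irreducible_def)
  show "y \<in> ?A \<union> ?B"
  proof (cases "translation_parts H = carrier R")
    case True
    let ?e = "card (linear_parts H)"
    note S = subgroup_eq_semidirect_unity_roots[OF Hs True]
    obtain m where m: "?N = ?e * m" using S(2) N by (metis dvdE)
    then have "primepow m" using meet_irreducible_unity_roots_iff[of ?e m] H(1) S(1) N by simp
    moreover have "?N div m = ?e" using m pos by (metis nonzero_mult_div_cancel_right mult_0_right not_gr0)
    ultimately have "y \<in> ?A" using H(2) True m by (force simp: class_invariant_def)
    then show ?thesis by blast
  next
    case False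
    then obtain K V g where KV: "subfield K R" "linear_parts H = K - {\<zero>}"
      using meet_irreducible_conjugate_semidirect[OF H(1)] by metis
    obtain d where d: "d dvd n" "card K = p ^ d" using card_subfield[OF KV(1) p q] by blast
    have "\<zero> \<in> K" "finite K"
      using subringE(2)[OF subfieldE(1)[OF KV(1)]] subfieldE(3)[OF KV(1)] finite_carrier finite_subset by auto
    then have "y = (p ^ d - 1, False)" using H(2) False KV(2) d(2) by (simp add: class_invariant_def)
    then show ?thesis using d(1) by blast
  qed
next
  let ?N = "p ^ n - 1"
  have N: "card (carrier R) - 1 = ?N" using q by simp
  fix y assume "y \<in> ?A \<union> ?B"
  then show "y \<in> ?L"
  proof
    assume "y \<in> ?A"
    then obtain m where m: "primepow m" "m dvd ?N" "y = (?N div m, True)" by blast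
    let ?S = "semidirect (unity_roots (?N div m)) (carrier R)"
    have "meet_irreducible (AGL1 R) ?S"
      using meet_irreducible_unity_roots_iff[of "?N div m" m] m(1,2) N by simp
    moreover have "card (unity_roots (?N div m)) = ?N div m"
      using m(2) N by (intro card_unity_roots) (metis dvd_def dvd_mult_div_cancel mult.commute)
    then have "y = class_invariant ?S"
      using m(3) semidirect_unity_roots(2,3) by (simp add: class_invariant_def)
    ultimately show ?thesis by blast
  next
    assume "y \<in> ?B"
    then obtain d where d: "d dvd n" "y = (p ^ d - 1, False)" by blast
    obtain K where K: "subfield K R" "card K = p ^ d" using subfield_exists[OF p q n d(1)] by blast
    obtain V where V: "maximal_subspace K V" using maximal_subspace_exists[OF K(1)] by blast
    then have V': "lin_subspace K V" "V \<noteq> carrier R" by (auto simp: maximal_subspace_def)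
    have "\<zero> \<in> K" "finite K"
      using subringE(2)[OF subfieldE(1)[OF K(1)]] subfieldE(3)[OF K(1)] finite_carrier finite_subset by auto
    then have "y = class_invariant (semidirect (K - {\<zero>}) V)"
      using d(2) K(2) subgroup_semidirect_subfield(2,3)[OF K(1) V'(1)] V'(2) by (simp add: class_invariant_def)
    then show ?thesis using meet_irreducible_semidirect_subfield[OF K(1) V] by blast
  qed
qed

theorem width_AGL1:
  assumes p: "Factorial_Ring.prime p" and n: "n \<ge> 1" and q: "card (carrier R) = p ^ n"
  shows "width (AGL1 R) = size (prime_factorization (p ^ n - 1)) + card {d. d dvd n}"
proof -
  let ?N = "p ^ n - 1"
  let ?A = "(\<lambda>m. (?N div m, True)) ` {m. primepow m \<and> m dvd ?N}"
  let ?B = "(\<lambda>d. (p ^ d - 1, False)) ` {d. d dvd n}"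
  have pos: "?N > 0" using order_gt_one q by simp
  have "carrier (AGL1 R) = (\<lambda>(l, m). aff l m) ` ((carrier R - {\<zero>}) \<times> carrier R)"
    by (auto simp: carrier_AGL semidirect_def)
  then have "finite (carrier (AGL1 R))" using finite_carrier by simp
  then have "width (AGL1 R) = card (class_invariant ` {M. meet_irreducible (AGL1 R) M})"
    using class_invariant_eq_iff by (rule AGL.width_eq_card_meet_irreducible_classes)
  also have "\<dots> = card (?A \<union> ?B)" using class_invariant_image[OF p n q] by simp
  \<comment> \<open>The flag makes the two families disjoint.\<close>
  also have "\<dots> = card ?A + card ?B"
    using pos n by (intro card_Un_disjoint finite_imageI) (auto intro: finite_subset[of _ "{..?N}"] simp: dvd_imp_le)
  also have "card ?A = card {m. primepow m \<and> m dvd ?N}"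
  proof (intro card_image inj_onI)
    fix k m assume km: "k \<in> {m. primepow m \<and> m dvd ?N}" "m \<in> {m. primepow m \<and> m dvd ?N}"
      "(?N div k, True) = (?N div m, True)"
    then have "?N div k = ?N div m" by simp
    moreover have "?N div k * k = ?N" "?N div m * m = ?N" using km(1,2) by simp_all
    ultimately have *: "?N div k * k = ?N" "?N div k * m = ?N" by (simp_all only:)
    then have "?N div k \<noteq> 0" using pos by (metis mult_0 not_gr0)
    then show "k = m" using * by (metis mult_cancel1)
  qed
  also have "\<dots> = size (prime_factorization ?N)" by (rule card_primepow_factors[OF pos])
  also have "card ?B = card {d. d dvd n}"
  proof (intro card_image inj_onI)
    fix c d assume "(p ^ c - 1, False) = (p ^ d - 1, False)"
    then have "p ^ c - 1 = p ^ d - 1" by simp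
    moreover have "p ^ c > 0" "p ^ d > 0" using prime_gt_0_nat[OF p] by simp_all
    ultimately have "p ^ c = p ^ d" by linarith
    then show "c = d" using prime_gt_1_nat[OF p] power_inject_exp by blast
  qed
  finally show ?thesis .
qed

end

theorem theoremB:
  fixes p n :: nat and F :: "('a, 'b) ring_scheme"
  assumes "Factorial_Ring.prime p"
    and "n \<ge> 1"
    and "field F"
    and "card (carrier F) = p ^ n"
  shows "width (AGL1 F) = size (prime_factorization (p ^ n - 1)) + card {d. d dvd n}"
proof -
  \<comment> \<open>Infinite sets have \<open>card\<close> equal to 0, so a positive order also
    supplies finiteness.\<close>
  have "card (carrier F) \<noteq> 0" using assms(1,4) prime_gt_0_nat[of p] by simp
  then have "finite_field F"
    using assms(3) by (simp add: finite_field_def finite_field_axioms_def card_eq_0_iff)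
  then show ?thesis by (rule finite_field.width_AGL1[OF _ assms(1,2,4)])
qed

end
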